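(* Let $\pi\in\mathcal{P}(\mathbb{T}^d)$ and let $\eta:G\to[0,\infty)$, where $G=\{(x,y)\in\mathbb{T}^d\times\mathbb{T}^d:x\ne y\}$, be such that the pair $\{\eta,\pi\}$ satisfies (J1)--(J3) of the context. Let $n$ range over the powers of $2$, and for each $n$ let $\{x_j^n\}_{j=1}^{n^d}$ be an evenly spaced grid of points in $\mathbb{T}^d$, such that $\{x_j^m\}_{j=1}^{m^d}\subseteq\{x_j^n\}_{j=1}^{n^d}$ for $m\le n$. Let $T_n:\mathbb{T}^d\to\{x_j^n\}_j$ be a measurable map sending each $x$ to a nearest grid point (ties broken in an arbitrary measurable fashion), let $\pi_n=\pi\circ T_n^{-1}$ be the pushforward of $\pi$, and let $\delta_n=\mathrm{diam}\,T_n^{-1}(x_j^n)$ (independent of $j$). For distinct grid points (of positive $\pi_n$-mass) define $$\eta_n(x_j^n,x_k^n)=\frac{1}{\pi_n(x_j^n)\,\pi_n(x_k^n)}\iint_{T_n^{-1}(x_j^n)\times T_n^{-1}(x_k^n)}1_{\{|x-y|\ge\delta_n/2\}}\,\eta(x,y)\,d\pi(x)\,d\pi(y).$$ Then the entire family $\{\eta_n,\pi_n\}_{n}\cup\{\eta,\pi\}$ satisfies (J2)--(J3). Moreover, if $\eta$ is continuous and strictly positive on $G$ and $\frac{d\pi}{dx}$ is uniformly bounded from below (by a positive constant) on $\mathbb{T}^d$, then each $\eta_n$ can be extended to a continuous function on all of $G$ in such a way that $\eta_n\to\eta$ uniformly on compact subsets of $G$.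
   Context: $\mathbb{T}^d$ is the flat torus with distance $|x-y|$; $\mathcal{P}(\mathbb{T}^d)$ is the set of Borel probability measures. Compact subsets of $G$ are separated from the diagonal. Conditions on a family $\{\eta_i,\pi_i\}_{i\in I}$ (with $\eta_i\ge 0$ defined at least on pairs of distinct points of $\mathrm{supp}(\pi_i)$; the diagonal never contributes to the integrals below): (J1) $\eta_i(x,y)=\eta_i(y,x)$ for all $x\ne y$ in $\mathrm{supp}(\pi_i)$. (J2) For each bounded continuous $f:\mathbb{T}^d\to\mathbb{R}$ and each $i$ the function $\mathrm{supp}(\pi_i)\ni x\mapsto\int f(y)(1\wedge|x-y|^2)\eta_i(x,y)d\pi_i(y)$ is bounded and continuous, and $\sup_{i\in I}\sup_{x\in\mathrm{supp}(\pi_i)}\int f(y)(1\wedge|x-y|^2)\eta_i(x,y)d\pi_i(y)<\infty$. (J3) $\lim_{R\to\infty}\sup_{i\in I}\sup_{x\in\mathrm{supp}(\pi_i)}\int_{A_R(x)}(1\wedge|x-y|^2)\eta_i(x,y)d\pi_i(y)=0$, where $A_R(x)=\{y:|x-y|<1/R\text{ or }|x-y|>R\}$. *)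

theory Defs
  imports "HOL-Probability.Probability"
begin

section \<open>The flat torus\<close>

definition int_lattice :: "(real ^ 'd::finite) set"
  where "int_lattice = {k. \<forall>i. k $ i \<in> \<int>}"

lemma int_lattice_zero: "0 \<in> int_lattice"
  by (simp add: int_lattice_def)

lemma int_lattice_nonempty: "int_lattice \<noteq> {}"
  using int_lattice_zero by blast

lemma int_lattice_add: "k \<in> int_lattice \<Longrightarrow> l \<in> int_lattice \<Longrightarrow> k + l \<in> int_lattice"
  by (simp add: int_lattice_def)

lemma int_lattice_diff: "k \<in> int_lattice \<Longrightarrow> l \<in> int_lattice \<Longrightarrow> k - l \<in> int_lattice"
  by (simp add: int_lattice_def)

lemma int_lattice_minus: "k \<in> int_lattice \<Longrightarrow> - k \<in> int_lattice"
  by (simp add: int_lattice_def)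

lemma closed_int_lattice: "closed (int_lattice :: (real ^ 'd::finite) set)"
proof -
  have "closed {k :: real ^ 'd. k $ i \<in> \<int>}" for i
    using closed_vimage[OF closed_Ints, of "\<lambda>k :: real ^ 'd. k $ i"]
    by (simp add: vimage_def continuous_on_component)
  then show ?thesis
    unfolding int_lattice_def by (rule closed_Collect_all)
qed

quotient_type (overloaded) 'd torus = "real ^ 'd::finite" / "\<lambda>x y. x - y \<in> int_lattice"
  morphisms rep_torus to_torus
proof (rule equivpI)
  show "reflp (\<lambda>x y :: real ^ 'd. x - y \<in> int_lattice)"
    by (simp add: reflp_def int_lattice_zero)
  show "symp (\<lambda>x y :: real ^ 'd. x - y \<in> int_lattice)"
    proof (rule sympI)
    fix x y :: "real ^ 'd"
    assume "x - y \<in> int_lattice"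
    from int_lattice_minus[OF this] show "y - x \<in> int_lattice" by simp
  qed
  show "transp (\<lambda>x y :: real ^ 'd. x - y \<in> int_lattice)"
    proof (rule transpI)
    fix x y z :: "real ^ 'd"
    assume "x - y \<in> int_lattice" "y - z \<in> int_lattice"
    from int_lattice_add[OF this] show "x - z \<in> int_lattice" by simp
  qed
qed

lemma infdist_lattice_shift_le:
  assumes "l \<in> int_lattice"
  shows "infdist (x + l) int_lattice \<le> infdist x int_lattice"
proof -
  have "infdist (x + l) int_lattice \<le> dist x k" if "k \<in> int_lattice" for k
    using infdist_le[OF int_lattice_add[OF that assms], of "x + l"] by simp
  then show ?thesis
    using int_lattice_zero
    by (subst (2) infdist_def) (auto intro!: cINF_greatest)
qed

lemma infdist_lattice_shift:
  assumes "l \<in> int_lattice"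
  shows "infdist (x + l) int_lattice = infdist x int_lattice"
  using infdist_lattice_shift_le[OF assms, of x]
    infdist_lattice_shift_le[OF int_lattice_minus[OF assms], of "x + l"] by simp

lemma infdist_lattice_minus_le: "infdist (- x) int_lattice \<le> infdist x int_lattice"
proof -
  have "infdist (- x) int_lattice \<le> dist x k" if "k \<in> int_lattice" for k
    using infdist_le[OF int_lattice_minus[OF that], of "- x"] by (simp add: dist_minus)
  then show ?thesis
    using int_lattice_zero
    by (subst (2) infdist_def) (auto intro!: cINF_greatest)
qed

lemma infdist_lattice_triangle:
  "infdist (x + y) int_lattice \<le> infdist x int_lattice + infdist y int_lattice"
proof -
  have "infdist (x + y) int_lattice \<le> dist x k + infdist y int_lattice"
    if "k \<in> int_lattice" for k
  proof -
    have "infdist (x + y) int_lattice \<le> infdist (y + k) int_lattice + dist (x + y) (y + k)"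
      by (rule infdist_triangle)
    also have "\<dots> = infdist y int_lattice + dist x k"
      by (simp add: infdist_lattice_shift[OF that] add.commute[of x y])
    finally show ?thesis by simp
  qed
  then have "infdist (x + y) int_lattice - infdist y int_lattice \<le> (INF k\<in>int_lattice. dist x k)"
    by (intro cINF_greatest int_lattice_nonempty) (simp add: algebra_simps)
  then show ?thesis
    by (simp add: infdist_notempty[OF int_lattice_nonempty, of x])
qed

instantiation torus :: (finite) metric_space
begin

lift_definition dist_torus :: "'a torus \<Rightarrow> 'a torus \<Rightarrow> real"
  is "\<lambda>x y. infdist (x - y) int_lattice"
proof -
  fix x x' y y' :: "real ^ 'a"
  assume "x - x' \<in> int_lattice" "y - y' \<in> int_lattice"
  then have "(x - x') - (y - y') \<in> int_lattice"
    by (rule int_lattice_diff)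
  from infdist_lattice_shift[OF this, of "x' - y'"]
  show "infdist (x - y) int_lattice = infdist (x' - y') int_lattice"
    by (simp add: algebra_simps)
qed

definition uniformity_torus :: "('a torus \<times> 'a torus) filter"
  where "uniformity_torus = (INF e\<in>{0<..}. principal {(x, y). dist x y < e})"

definition open_torus :: "'a torus set \<Rightarrow> bool"
  where "open_torus U \<longleftrightarrow> (\<forall>x\<in>U. eventually (\<lambda>(x', y). x' = x \<longrightarrow> y \<in> U) uniformity)"

instance
proof
  show "dist x y = 0 \<longleftrightarrow> x = y" for x y :: "'a torus"
  proof (transfer)
    fix x y :: "real ^ 'a"
    show "infdist (x - y) int_lattice = 0 \<longleftrightarrow> x - y \<in> int_lattice"
      using in_closed_iff_infdist_zero[OF closed_int_lattice] int_lattice_zero by blast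
  qed
  show "dist x y \<le> dist x z + dist y z" for x y z :: "'a torus"
  proof (transfer)
    fix x y z :: "real ^ 'a"
    have "infdist (x - y) int_lattice \<le> infdist (x - z) int_lattice + infdist (- (y - z)) int_lattice"
      using infdist_lattice_triangle[of "x - z" "- (y - z)"] by simp
    also have "infdist (- (y - z)) int_lattice \<le> infdist (y - z) int_lattice"
      by (rule infdist_lattice_minus_le)
    finally show "infdist (x - y) int_lattice
        \<le> infdist (x - z) int_lattice + infdist (y - z) int_lattice"
      by simp
  qed
qed (simp_all add: uniformity_torus_def open_torus_def)

end

lemma dist_to_torus_le: "dist (to_torus x) (to_torus y) \<le> dist x y"
  using infdist_le[OF int_lattice_zero, of "x - y"]
  by (simp add: dist_torus.abs_eq dist_norm)

lemma continuous_on_to_torus: "continuous_on A to_torus"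
  unfolding continuous_on_iff by (meson dist_to_torus_le le_less_trans)

lemma borel_measurable_to_torus: "to_torus \<in> borel_measurable borel"
  by (intro borel_measurable_continuous_onI continuous_on_to_torus)

definition torus_lebesgue :: "'d::finite torus measure"
  where "torus_lebesgue =
    distr (restrict_space lborel {x :: real ^ 'd. \<forall>i. 0 \<le> x $ i \<and> x $ i < 1}) borel to_torus"

definition off_diagonal :: "('a \<times> 'a) set"
  where "off_diagonal = {(x, y). x \<noteq> y}"


section \<open>Conditions on families of kernels and measures\<close>

definition msupport :: "'a::topological_space measure \<Rightarrow> 'a set"
  where "msupport \<mu> = {x. \<forall>U. open U \<and> x \<in> U \<longrightarrow> emeasure \<mu> U > 0}"

text \<open>
  A family is a set of pairs \<open>(\<eta>, \<pi>)\<close>. Kernels are total functions, but the conditions only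
  look at their values at distinct points of the support of \<open>\<pi>\<close>: integrals are taken over
  the support, which has full measure, and \<open>min 1 \<bar>x - y\<bar>\<^sup>2\<close> vanishes on the diagonal.
\<close>

type_synonym 'a kernel_family = "(('a \<Rightarrow> 'a \<Rightarrow> real) \<times> 'a measure) set"

definition weighted_kernel :: "('a::metric_space \<Rightarrow> 'a \<Rightarrow> real) \<Rightarrow> 'a \<Rightarrow> 'a \<Rightarrow> real"
  where "weighted_kernel \<eta> x y = min 1 ((dist x y)\<^sup>2) * \<eta> x y"

definition J1 :: "'a::metric_space kernel_family \<Rightarrow> bool"
  where "J1 F \<longleftrightarrow>
    (\<forall>(\<eta>, \<pi>)\<in>F. \<forall>x\<in>msupport \<pi>. \<forall>y\<in>msupport \<pi>. x \<noteq> y \<longrightarrow> \<eta> x y = \<eta> y x)"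

definition kernel_integral ::
  "('a::metric_space \<Rightarrow> real) \<Rightarrow> ('a \<Rightarrow> 'a \<Rightarrow> real) \<Rightarrow> 'a measure \<Rightarrow> 'a \<Rightarrow> real"
  where "kernel_integral f \<eta> \<pi> x = (LINT y:msupport \<pi>|\<pi>. f y * weighted_kernel \<eta> x y)"

text \<open>Integrability is explicit because the Bochner integral is \<open>0\<close> where it is undefined.\<close>

definition J2 :: "'a::metric_space kernel_family \<Rightarrow> bool"
  where "J2 F \<longleftrightarrow>
    (\<forall>f :: 'a \<Rightarrow> real. continuous_on UNIV f \<and> bounded (range f) \<longrightarrow>
      (\<forall>(\<eta>, \<pi>)\<in>F.
        (\<forall>x\<in>msupport \<pi>. set_integrable \<pi> (msupport \<pi>) (\<lambda>y. f y * weighted_kernel \<eta> x y)) \<and>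
        bounded (kernel_integral f \<eta> \<pi> ` msupport \<pi>) \<and>
        continuous_on (msupport \<pi>) (kernel_integral f \<eta> \<pi>)) \<and>
      (SUP (\<eta>, \<pi>)\<in>F. SUP x\<in>msupport \<pi>. ereal (kernel_integral f \<eta> \<pi> x)) < \<infinity>)"

definition J3 :: "'a::metric_space kernel_family \<Rightarrow> bool"
  where "J3 F \<longleftrightarrow>
    ((\<lambda>R :: real. SUP (\<eta>, \<pi>)\<in>F. SUP x\<in>msupport \<pi>.
        \<integral>\<^sup>+ y \<in> msupport \<pi> \<inter> {y. dist x y < 1 / R \<or> dist x y > R}.
          ennreal (weighted_kernel \<eta> x y) \<partial>\<pi>) \<longlongrightarrow> 0) at_top"


section \<open>Grids and discretised kernels\<close>

text \<open>A translate of the lattice of mesh \<open>1 / n\<close>; it has \<open>n ^ d\<close> points on the torus.\<close>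

definition evenly_spaced_grid :: "nat \<Rightarrow> 'd::finite torus set \<Rightarrow> bool"
  where "evenly_spaced_grid n S \<longleftrightarrow>
    (\<exists>a. S = {to_torus (a + (1 / real n) *\<^sub>R k) | k. k \<in> int_lattice})"

definition nearest_point_map :: "'a::metric_space set \<Rightarrow> ('a \<Rightarrow> 'a) \<Rightarrow> bool"
  where "nearest_point_map S T \<longleftrightarrow>
    T \<in> borel \<rightarrow>\<^sub>M borel \<and> (\<forall>z. T z \<in> S \<and> (\<forall>p\<in>S. dist z (T z) \<le> dist z p))"

definition discrete_measure :: "('a::metric_space \<Rightarrow> 'a) \<Rightarrow> 'a measure \<Rightarrow> 'a measure"
  where "discrete_measure T \<pi> = distr \<pi> borel T"

text \<open>Meaningful for distinct \<open>p\<close> and \<open>q\<close> of positive mass.\<close>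

definition discrete_kernel ::
  "('a::metric_space \<Rightarrow> 'a) \<Rightarrow> real \<Rightarrow> 'a measure \<Rightarrow> ('a \<Rightarrow> 'a \<Rightarrow> real) \<Rightarrow> 'a \<Rightarrow> 'a \<Rightarrow> real"
  where "discrete_kernel T \<delta> \<pi> \<eta> p q =
    1 / (measure (discrete_measure T \<pi>) {p} * measure (discrete_measure T \<pi>) {q}) *
    (LINT (x, y):(T -` {p}) \<times> (T -` {q})|(\<pi> \<Otimes>\<^sub>M \<pi>).
      indicator {(x, y). dist x y \<ge> \<delta> / 2} (x, y) * \<eta> x y)"

end

theory Submission
  imports Defs
begin

text \<open>
  If \<open>x\<close> and \<open>y\<close> lie in the cells of distinct grid points \<open>p\<close> and \<open>q\<close> and \<open>\<bar>x - y\<bar> \<ge> \<delta> / 2\<close>, then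
  \<open>\<bar>p - q\<bar> \<le> \<bar>x - y\<bar> + \<delta> \<le> 3 \<bar>x - y\<bar>\<close>, because points of a cell are within \<open>\<delta> / 2\<close> of its centre.
  So by Fubini the integral of the discretised weighted kernel at \<open>p\<close> is at most \<open>9\<close> times an average,
  over \<open>x\<close> in the cell of \<open>p\<close>, of the integral of the original one at \<open>x\<close>; this gives (J2). For (J3),
  \<open>\<bar>p - q\<bar> < 1 / R\<close> forces the mesh below \<open>1 / R\<close>, hence \<open>\<bar>x - y\<bar> < (1 + \<surd>d) / R\<close>. For the second
  part, \<open>\<eta>\<close> is corrected near each pair of grid points by a small bump of disjoint support; the corrections
  tend to \<open>0\<close> away from the diagonal because \<open>\<eta>\<close> is uniformly continuous there and every cell has
  positive mass.
\<close>

section \<open>Supports and discretised kernels\<close>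

lemma AE_msupport:
  fixes \<mu> :: "'a::second_countable_topology measure"
  assumes "sets \<mu> = sets borel"
  shows "AE x in \<mu>. x \<in> msupport \<mu>"
proof -
  let ?F = "{U. open U \<and> emeasure \<mu> U = 0}"
  obtain F' where F': "F' \<subseteq> ?F" "countable F'" "\<Union>F' = \<Union>?F"
    using Lindelof[of ?F] by blast
  have "U \<in> null_sets \<mu>" if "U \<in> F'" for U
    using that F' assms by (auto simp: null_sets_def)
  then have "\<Union>F' \<in> null_sets \<mu>"
    using F'(2) null_sets_UN'[of F' "\<lambda>U. U" \<mu>] by simp
  moreover have "{x \<in> space \<mu>. x \<notin> msupport \<mu>} \<subseteq> \<Union>F'"
    unfolding F'(3) by (auto simp: msupport_def)
  ultimately show ?thesis by (rule AE_I')
qed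

lemma emeasure_discrete_measure:
  fixes \<pi> :: "'a::metric_space measure"
  assumes "T \<in> borel \<rightarrow>\<^sub>M borel" "sets \<pi> = sets borel" "A \<in> sets borel"
  shows "emeasure (discrete_measure T \<pi>) A = emeasure \<pi> (T -` A)"
proof -
  have "space \<pi> = UNIV" using sets_eq_imp_space_eq[OF assms(2)] by simp
  moreover have "T \<in> \<pi> \<rightarrow>\<^sub>M borel" using assms(1) by (simp add: measurable_cong_sets[OF assms(2)])
  ultimately show ?thesis using assms(3) by (simp add: discrete_measure_def emeasure_distr)
qed

lemma msupport_discrete_measureD:
  fixes \<pi> :: "'a::metric_space measure"
  assumes "T \<in> borel \<rightarrow>\<^sub>M borel" "sets \<pi> = sets borel"
    and "finite S" "\<And>z. T z \<in> S" and p: "p \<in> msupport (discrete_measure T \<pi>)"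
  shows "p \<in> S" "emeasure (discrete_measure T \<pi>) {p} > 0"
proof -
  let ?U = "- (S - {p})"
  have "open ?U" using assms(3) by (intro open_Compl finite_imp_closed) simp
  then have "emeasure (discrete_measure T \<pi>) ?U > 0"
    using p by (auto simp: msupport_def)
  moreover have "T -` ?U = T -` {p}" using assms(4) by auto
  ultimately show pos: "emeasure (discrete_measure T \<pi>) {p} > 0"
    using \<open>open ?U\<close> assms(1,2) by (simp add: emeasure_discrete_measure)
  then have "T -` {p} \<noteq> {}"
    using assms(1,2) by (auto simp: emeasure_discrete_measure)
  then show "p \<in> S" using assms(4) by auto
qed

lemma weighted_kernel_self [simp]: "weighted_kernel \<eta> x x = 0"
  by (simp add: weighted_kernel_def)

lemma weighted_kernel_nonneg:
  assumes "\<And>y z. y \<noteq> z \<Longrightarrow> 0 \<le> \<eta> y z"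
  shows "0 \<le> weighted_kernel \<eta> x y"
  using assms[of x y] by (cases "x = y") (auto simp: weighted_kernel_def)

lemma discrete_kernel_nonneg:
  assumes "\<And>y z. y \<noteq> z \<Longrightarrow> 0 \<le> \<eta> y z" "p \<noteq> q"
  shows "0 \<le> discrete_kernel T \<delta> \<pi> \<eta> p q"
  unfolding discrete_kernel_def set_lebesgue_integral_def
  using assms(2)
  by (intro mult_nonneg_nonneg integral_nonneg_AE AE_I2)
    (auto simp: indicator_def intro!: assms(1))

text \<open>
  The hypothesis \<open>near\<close> is restricted to maps with two distinct values because it fails for the
  one-point grid, where \<open>\<delta>\<close> is the diameter of the whole torus.
\<close>

lemma nn_integral_discrete_kernel_le:
  fixes \<pi> :: "'a::{metric_space, second_countable_topology} measure"
  assumes "prob_space \<pi>" and sets: "sets \<pi> = sets borel"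
    and nonneg: "\<And>y z. y \<noteq> z \<Longrightarrow> 0 \<le> \<eta> y z"
    and T: "T \<in> borel \<rightarrow>\<^sub>M borel" and S: "finite S" "\<And>z. T z \<in> S"
    and near: "\<And>y z. T y \<noteq> T z \<Longrightarrow> dist z (T z) \<le> \<delta> / 2"
    and p: "p \<in> msupport (discrete_measure T \<pi>)"
    and C: "\<And>x y. T x = p \<Longrightarrow> T y \<noteq> p \<Longrightarrow> T y \<in> B \<Longrightarrow> (x, y) \<in> C"
    and M: "\<And>x. x \<in> msupport \<pi> \<Longrightarrow>
      (\<integral>\<^sup>+ y \<in> msupport \<pi> \<inter> {y. (x, y) \<in> C}. ennreal (weighted_kernel \<eta> x y) \<partial>\<pi>) \<le> M"
  shows "(\<integral>\<^sup>+ q \<in> msupport (discrete_measure T \<pi>) \<inter> B.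
      ennreal (weighted_kernel (discrete_kernel T \<delta> \<pi> \<eta>) p q) \<partial>discrete_measure T \<pi>) \<le> 9 * M"
proof -
  interpret prob_space \<pi> by fact
  interpret P: pair_sigma_finite \<pi> \<pi> ..
  let ?\<nu> = "discrete_measure T \<pi>"
  have space: "space \<pi> = UNIV" using sets_eq_imp_space_eq[OF sets] by simp
  have T': "T \<in> \<pi> \<rightarrow>\<^sub>M borel" using T by (simp add: measurable_cong_sets[OF sets])
  have "prob_space ?\<nu>" unfolding discrete_measure_def using T' by (rule prob_space_distr)
  then interpret D: prob_space ?\<nu> .
  define F where "F = msupport ?\<nu> \<inter> B"
  have FS: "F \<subseteq> S" using msupport_discrete_measureD(1)[OF T sets S] by (auto simp: F_def)
  then have finF: "finite F" using S finite_subset by blast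
  have setsD: "sets ?\<nu> = sets borel" by (simp add: discrete_measure_def)
  define m where "m q = measure ?\<nu> {q}" for q
  have m_pos: "m q > 0" if "q \<in> msupport ?\<nu>" for q
    using msupport_discrete_measureD(2)[OF T sets S that]
    by (simp add: m_def D.emeasure_eq_measure)
  have cell: "T -` {q} \<in> sets \<pi>" for q
    using measurable_sets[OF T', of "{q}"] space by simp
  define g where "g q z = indicator ((T -` {p}) \<times> (T -` {q})) z *
      (indicator {(x, y). dist x y \<ge> \<delta> / 2} z * \<eta> (fst z) (snd z))" for q z
  define w where "w q = min 1 ((dist p q)\<^sup>2)" for q
  have w_nonneg: "0 \<le> w q" for q by (simp add: w_def)
  have g_nonneg: "0 \<le> g q z" if "q \<noteq> p" for q z
    using that by (auto simp: g_def indicator_def intro!: nonneg)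
  define I where "I q = (\<integral>z. g q z \<partial>(\<pi> \<Otimes>\<^sub>M \<pi>))" for q
  have dk: "discrete_kernel T \<delta> \<pi> \<eta> p q = 1 / (m p * m q) * I q" for q
    unfolding discrete_kernel_def set_lebesgue_integral_def I_def g_def m_def
    by (simp add: case_prod_beta)
  \<comment> \<open>\<open>\<eta>\<close> need not be jointly measurable. Where \<open>g q\<close> is not integrable, the Bochner integral \<open>I q\<close>
    is \<open>0\<close>, so the pair may be dropped before applying Fubini.\<close>
  define G where "G q z = (if integrable (\<pi> \<Otimes>\<^sub>M \<pi>) (g q) then ennreal (w q * g q z) else 0)" for q z
  have G_meas: "G q \<in> borel_measurable (\<pi> \<Otimes>\<^sub>M \<pi>)" for q
    unfolding G_def by (cases "integrable (\<pi> \<Otimes>\<^sub>M \<pi>) (g q)") auto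
  have GI: "ennreal (w q * I q) = (\<integral>\<^sup>+ z. G q z \<partial>(\<pi> \<Otimes>\<^sub>M \<pi>))" if "q \<noteq> p" for q
  proof (cases "integrable (\<pi> \<Otimes>\<^sub>M \<pi>) (g q)")
    case True
    then show ?thesis using g_nonneg[OF that] w_nonneg
      by (simp add: G_def I_def nn_integral_eq_integral)
  next
    case False
    then show ?thesis by (simp add: G_def I_def not_integrable_integral_eq)
  qed
  have G_0: "G q (x, y) = 0" if "\<not> (T x = p \<and> T y = q \<and> dist x y \<ge> \<delta> / 2)" for q x y
  proof -
    have "g q (x, y) = 0" using that by (auto simp: g_def)
    then show ?thesis by (simp add: G_def)
  qed
  have ninth: "9 * a / 9 = a" for a :: ennreal
    using ennreal_mult_divide_eq[of 9 a] by (subst mult.commute) simp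
  have pointwise: "(\<Sum>q\<in>F - {p}. G q (x, y)) \<le>
      indicator (T -` {p}) x * (9 * (ennreal (weighted_kernel \<eta> x y) * indicator {y. (x, y) \<in> C} y))"
    for x y
  proof (cases "T x = p \<and> T y \<in> F - {p} \<and> dist x y \<ge> \<delta> / 2")
    case False
    then have "G q (x, y) = 0" if "q \<in> F - {p}" for q
      using that by (intro G_0) auto
    then show ?thesis by simp
  next
    case True
    then have xy: "T x \<noteq> T y" "(x, y) \<in> C" using C[of x y] by (auto simp: F_def)
    have "(\<Sum>q\<in>F - {p}. G q (x, y)) = (\<Sum>q\<in>F - {p}. if q = T y then G (T y) (x, y) else 0)"
      by (intro sum.cong) (auto intro: G_0)
    also have "\<dots> = G (T y) (x, y)" using True finF by simp
    also have "\<dots> \<le> ennreal (w (T y) * \<eta> x y)"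
      using True by (simp add: G_def g_def)
    also have "\<dots> \<le> ennreal (9 * weighted_kernel \<eta> x y)"
    proof (rule ennreal_leI)
      have "dist p (T y) \<le> dist x (T x) + dist x y + dist y (T y)"
        using True dist_triangle[of p "T y" x] dist_triangle[of x "T y" y] by (simp add: dist_commute)
      also have "\<dots> \<le> 3 * dist x y" using near[of x y] near[of y x] xy True by auto
      finally have "(dist p (T y))\<^sup>2 \<le> (3 * dist x y)\<^sup>2" by (intro power_mono) auto
      then have "w (T y) \<le> 9 * min 1 ((dist x y)\<^sup>2)"
        by (auto simp: w_def power_mult_distrib min_def)
      moreover have "0 \<le> \<eta> x y" by (rule nonneg) (use xy in auto)
      ultimately show "w (T y) * \<eta> x y \<le> 9 * weighted_kernel \<eta> x y"
        using mult_right_mono[of "w (T y)" "9 * min 1 ((dist x y)\<^sup>2)" "\<eta> x y"]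
        by (simp add: weighted_kernel_def mult.assoc)
    qed
    also have "\<dots> = 9 * ennreal (weighted_kernel \<eta> x y)"
      using weighted_kernel_nonneg[of \<eta>, OF nonneg] by (simp add: ennreal_mult)
    finally show ?thesis using True xy by simp
  qed
  have "(\<Sum>q\<in>F - {p}. ennreal (w q * I q)) = (\<integral>\<^sup>+ z. (\<Sum>q\<in>F - {p}. G q z) \<partial>(\<pi> \<Otimes>\<^sub>M \<pi>))"
    using GI G_meas by (simp add: nn_integral_sum)
  also have "\<dots> = (\<integral>\<^sup>+ x. \<integral>\<^sup>+ y. (\<Sum>q\<in>F - {p}. G q (x, y)) \<partial>\<pi> \<partial>\<pi>)"
    using G_meas by (subst nn_integral_fst) auto
  also have "\<dots> \<le> (\<integral>\<^sup>+ x. 9 * M * indicator (T -` {p}) x \<partial>\<pi>)"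
  proof (rule nn_integral_mono_AE)
    show "AE x in \<pi>. (\<integral>\<^sup>+ y. (\<Sum>q\<in>F - {p}. G q (x, y)) \<partial>\<pi>) \<le> 9 * M * indicator (T -` {p}) x"
      using AE_msupport[OF sets]
    proof eventually_elim
      fix x assume x: "x \<in> msupport \<pi>"
      define h where "h y = (\<Sum>q\<in>F - {p}. G q (x, y))" for y
      have h_meas: "h \<in> borel_measurable \<pi>"
        unfolding h_def using measurable_compose_Pair1[of x \<pi>, OF _ G_meas] space by simp
      have "AE y in \<pi>. h y / 9 \<le> ennreal (weighted_kernel \<eta> x y)
          * indicator (msupport \<pi> \<inter> {y. (x, y) \<in> C}) y * indicator (T -` {p}) x"
        using AE_msupport[OF sets]
      proof eventually_elim
        fix y assume "y \<in> msupport \<pi>"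
        then show "h y / 9 \<le> ennreal (weighted_kernel \<eta> x y)
          * indicator (msupport \<pi> \<inter> {y. (x, y) \<in> C}) y * indicator (T -` {p}) x"
          using divide_right_mono_ennreal[OF pointwise[of x y], of 9]
          by (cases "T x = p"; cases "(x, y) \<in> C") (simp_all add: h_def ninth)
      qed
      then have "(\<integral>\<^sup>+ y. h y / 9 \<partial>\<pi>) \<le> (\<integral>\<^sup>+ y. ennreal (weighted_kernel \<eta> x y)
          * indicator (msupport \<pi> \<inter> {y. (x, y) \<in> C}) y * indicator (T -` {p}) x \<partial>\<pi>)"
        by (rule nn_integral_mono_AE)
      also have "\<dots> \<le> M * indicator (T -` {p}) x"
        using M[OF x] by (auto simp: indicator_def)
      finally have "(\<integral>\<^sup>+ y. h y / 9 \<partial>\<pi>) \<le> M * indicator (T -` {p}) x" .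
      then have "9 * (\<integral>\<^sup>+ y. h y / 9 \<partial>\<pi>) \<le> 9 * (M * indicator (T -` {p}) x)"
        by (rule mult_left_mono) simp
      moreover have "9 * (\<integral>\<^sup>+ y. h y / 9 \<partial>\<pi>) = (\<integral>\<^sup>+ y. h y \<partial>\<pi>)"
      proof -
        have "9 * (h y / 9) = h y" for y
          by (simp add: ennreal_times_divide ninth)
        then show ?thesis using h_meas by (subst nn_integral_cmult[symmetric]) auto
      qed
      ultimately show "(\<integral>\<^sup>+ y. (\<Sum>q\<in>F - {p}. G q (x, y)) \<partial>\<pi>) \<le> 9 * M * indicator (T -` {p}) x"
        by (simp add: h_def mult.assoc)
    qed
  qed
  also have "\<dots> = 9 * M * ennreal (m p)"
    using cell emeasure_discrete_measure[OF T sets, of "{p}"]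
    by (simp add: nn_integral_cmult_indicator m_def D.emeasure_eq_measure)
  finally have main: "(\<Sum>q\<in>F - {p}. ennreal (w q * I q)) \<le> 9 * M * ennreal (m p)" .
  have "(\<integral>\<^sup>+ q \<in> F. ennreal (weighted_kernel (discrete_kernel T \<delta> \<pi> \<eta>) p q) \<partial>?\<nu>)
      = (\<Sum>q\<in>F. ennreal (weighted_kernel (discrete_kernel T \<delta> \<pi> \<eta>) p q) * emeasure ?\<nu> {q})"
    using finF setsD by (intro nn_integral_indicator_finite) auto
  also have "\<dots> = (\<Sum>q\<in>F - {p}. ennreal (weighted_kernel (discrete_kernel T \<delta> \<pi> \<eta>) p q) * emeasure ?\<nu> {q})"
    using finF by (intro sum.mono_neutral_right) auto
  also have "\<dots> = (\<Sum>q\<in>F - {p}. ennreal (w q * I q) * ennreal (1 / m p))"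
  proof (rule sum.cong)
    fix q assume q: "q \<in> F - {p}"
    then have "m q > 0" "m p > 0" using m_pos p by (auto simp: F_def)
    then have eq: "weighted_kernel (discrete_kernel T \<delta> \<pi> \<eta>) p q * m q = w q * I q * (1 / m p)"
      by (simp add: weighted_kernel_def w_def dk)
    have Inn: "0 \<le> I q" using g_nonneg q by (auto simp: I_def intro!: integral_nonneg_AE)
    show "ennreal (weighted_kernel (discrete_kernel T \<delta> \<pi> \<eta>) p q) * emeasure ?\<nu> {q} =
        ennreal (w q * I q) * ennreal (1 / m p)"
      using eq \<open>m q > 0\<close> \<open>m p > 0\<close> w_nonneg Inn
      by (metis D.emeasure_eq_measure m_def ennreal_mult'' less_imp_le zero_le_divide_1_iff)
  qed simp
  also have "\<dots> = (\<Sum>q\<in>F - {p}. ennreal (w q * I q)) * ennreal (1 / m p)"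
    by (simp add: sum_distrib_right)
  also have "\<dots> \<le> 9 * M * ennreal (m p) * ennreal (1 / m p)"
    using main by (rule mult_right_mono) simp
  also have "\<dots> = 9 * M"
    using m_pos[OF p] by (simp add: mult.assoc ennreal_mult[symmetric])
  finally show ?thesis unfolding F_def .
qed

lemma integrable_indicator_finite:
  fixes f :: "'a \<Rightarrow> real"
  assumes "finite_measure M" "finite F" "\<And>a. a \<in> F \<Longrightarrow> {a} \<in> sets M"
  shows "integrable M (\<lambda>x. indicator F x * f x)"
proof -
  interpret finite_measure M by fact
  have "integrable M (\<lambda>x. \<Sum>a\<in>F. indicator {a} x * f a)"
    using assms(3) by (intro Bochner_Integration.integrable_sum integrable_mult_left
        integrable_real_indicator) (auto simp: less_top[symmetric])
  moreover have "(\<Sum>a\<in>F. indicator {a} x * f a) = indicator F x * f x" for x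
    using assms(2) by (auto simp: indicator_def if_distrib[of "\<lambda>c. c * _"] cong: if_cong)
  ultimately show ?thesis by simp
qed

lemma kernel_integral_discrete_kernel_bound:
  fixes \<pi> :: "'a::{metric_space, second_countable_topology} measure"
  assumes \<pi>: "prob_space \<pi>" and sets: "sets \<pi> = sets borel"
    and nonneg: "\<And>y z. y \<noteq> z \<Longrightarrow> 0 \<le> \<eta> y z"
    and T: "T \<in> borel \<rightarrow>\<^sub>M borel" and S: "finite S" "\<And>z. T z \<in> S"
    and near: "\<And>y z. T y \<noteq> T z \<Longrightarrow> dist z (T z) \<le> \<delta> / 2"
    and p: "p \<in> msupport (discrete_measure T \<pi>)"
    and M: "0 \<le> M" "\<And>x. x \<in> msupport \<pi> \<Longrightarrow>
      (\<integral>\<^sup>+ y \<in> msupport \<pi>. ennreal (weighted_kernel \<eta> x y) \<partial>\<pi>) \<le> ennreal M"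
    and K: "0 \<le> K" "\<And>q. \<bar>f q\<bar> \<le> K"
  shows "\<bar>kernel_integral f (discrete_kernel T \<delta> \<pi> \<eta>) (discrete_measure T \<pi>) p\<bar> \<le> K * (9 * M)"
proof -
  let ?\<nu> = "discrete_measure T \<pi>" and ?k = "discrete_kernel T \<delta> \<pi> \<eta>"
  interpret prob_space \<pi> by fact
  have "T \<in> \<pi> \<rightarrow>\<^sub>M borel" using T by (simp add: measurable_cong_sets[OF sets])
  then interpret D: prob_space ?\<nu> unfolding discrete_measure_def by (rule prob_space_distr)
  have setsD: "sets ?\<nu> = sets borel" by (simp add: discrete_measure_def)
  have fin: "finite (msupport ?\<nu>)"
    using msupport_discrete_measureD(1)[OF T sets S] S(1) by (meson finite_subset subsetI)
  have wk: "0 \<le> weighted_kernel ?k p q" for q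
    by (rule weighted_kernel_nonneg, rule discrete_kernel_nonneg, rule nonneg)
  have int: "integrable ?\<nu> (\<lambda>q. indicator (msupport ?\<nu>) q * h q)" for h :: "'a \<Rightarrow> real"
    using D.finite_measure_axioms fin setsD by (intro integrable_indicator_finite) auto
  have "(\<integral>\<^sup>+ q \<in> msupport ?\<nu> \<inter> UNIV. ennreal (weighted_kernel ?k p q) \<partial>?\<nu>) \<le> 9 * ennreal M"
    by (rule nn_integral_discrete_kernel_le[where C = UNIV, OF \<pi> sets nonneg T S near p])
      (use M in auto)
  moreover have "(\<integral>\<^sup>+ q \<in> msupport ?\<nu>. ennreal (weighted_kernel ?k p q) \<partial>?\<nu>) =
      ennreal (\<integral>q. indicator (msupport ?\<nu>) q * weighted_kernel ?k p q \<partial>?\<nu>)"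
    using wk by (subst nn_integral_eq_integral[OF int, symmetric])
      (auto intro!: nn_integral_cong simp: indicator_def)
  ultimately have "ennreal (\<integral>q. indicator (msupport ?\<nu>) q * weighted_kernel ?k p q \<partial>?\<nu>) \<le> ennreal (9 * M)"
    using M(1) by (simp add: ennreal_mult)
  then have "(\<integral>q. indicator (msupport ?\<nu>) q * weighted_kernel ?k p q \<partial>?\<nu>) \<le> 9 * M"
    using M(1) by (simp add: ennreal_le_iff)
  then have le: "K * (\<integral>q. indicator (msupport ?\<nu>) q * weighted_kernel ?k p q \<partial>?\<nu>) \<le> K * (9 * M)"
    using K(1) by (rule mult_left_mono)
  have "\<bar>kernel_integral f ?k ?\<nu> p\<bar> \<le>
      (\<integral>q. K * (indicator (msupport ?\<nu>) q * weighted_kernel ?k p q) \<partial>?\<nu>)"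
    unfolding kernel_integral_def set_lebesgue_integral_def real_norm_def[symmetric]
  proof (rule order_trans[OF integral_norm_bound integral_mono])
    show "integrable ?\<nu> (\<lambda>q. norm (indicat_real (msupport ?\<nu>) q *\<^sub>R (f q * weighted_kernel ?k p q)))"
      using int[of "\<lambda>q. f q * weighted_kernel ?k p q"] by (intro integrable_norm) simp
    show "integrable ?\<nu> (\<lambda>q. K * (indicat_real (msupport ?\<nu>) q * weighted_kernel ?k p q))"
      using int by (rule integrable_mult_right)
    show "norm (indicat_real (msupport ?\<nu>) q *\<^sub>R (f q * weighted_kernel ?k p q)) \<le>
        K * (indicat_real (msupport ?\<nu>) q * weighted_kernel ?k p q)" for q
      using K(2)[of q] wk[of q] by (auto simp: indicator_def abs_mult mult_right_mono)
  qed
  also have "\<dots> = K * (\<integral>q. indicator (msupport ?\<nu>) q * weighted_kernel ?k p q \<partial>?\<nu>)"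
    by (rule integral_mult_right_zero)
  also note le
  finally show ?thesis .
qed

lemma J2_nn_integral_bound:
  assumes J2: "J2 {(\<eta>, \<pi>)}" and nonneg: "\<And>y z. y \<noteq> z \<Longrightarrow> 0 \<le> \<eta> y z"
  obtains M where "0 \<le> M" "\<And>x. x \<in> msupport \<pi> \<Longrightarrow>
      (\<integral>\<^sup>+ y \<in> msupport \<pi>. ennreal (weighted_kernel \<eta> x y) \<partial>\<pi>) \<le> ennreal M"
proof -
  let ?I = "kernel_integral (\<lambda>_. 1) \<eta> \<pi>"
  have "continuous_on UNIV (\<lambda>_ :: 'a. 1 :: real)" "bounded (range (\<lambda>_ :: 'a. 1 :: real))" by simp_all
  with J2[unfolded J2_def, rule_format, of "\<lambda>_. 1"] have bnd: "bounded (?I ` msupport \<pi>)"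
    and int: "\<And>x. x \<in> msupport \<pi> \<Longrightarrow> set_integrable \<pi> (msupport \<pi>) (\<lambda>y. 1 * weighted_kernel \<eta> x y)"
    by auto
  obtain M where M: "M > 0" "\<And>x. x \<in> msupport \<pi> \<Longrightarrow> \<bar>?I x\<bar> \<le> M"
    using bnd by (auto simp: bounded_pos)
  have "(\<integral>\<^sup>+ y \<in> msupport \<pi>. ennreal (weighted_kernel \<eta> x y) \<partial>\<pi>) \<le> ennreal M"
    if x: "x \<in> msupport \<pi>" for x
  proof -
    have wk: "0 \<le> weighted_kernel \<eta> x y" for y by (rule weighted_kernel_nonneg, rule nonneg)
    have "(\<integral>\<^sup>+ y \<in> msupport \<pi>. ennreal (weighted_kernel \<eta> x y) \<partial>\<pi>) =
        (\<integral>\<^sup>+ y. ennreal (indicat_real (msupport \<pi>) y *\<^sub>R (1 * weighted_kernel \<eta> x y)) \<partial>\<pi>)"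
      by (intro nn_integral_cong) (auto simp: indicator_def)
    also have "\<dots> = ennreal (?I x)"
      unfolding kernel_integral_def set_lebesgue_integral_def
      using int[OF x] wk by (intro nn_integral_eq_integral) (auto simp: set_integrable_def)
    also have "\<dots> \<le> ennreal M" using M(2)[OF x] by (intro ennreal_leI) auto
    finally show ?thesis .
  qed
  then show ?thesis using that M(1) by (meson less_imp_le)
qed

lemma J2_discretisation:
  fixes \<pi> :: "'a::{metric_space, second_countable_topology} measure" and T :: "'i \<Rightarrow> 'a \<Rightarrow> 'a"
  assumes \<pi>: "prob_space \<pi>" and sets: "sets \<pi> = sets borel"
    and nonneg: "\<And>y z. y \<noteq> z \<Longrightarrow> 0 \<le> \<eta> y z" and J2: "J2 {(\<eta>, \<pi>)}"
    and T: "\<And>i. i \<in> I \<Longrightarrow> T i \<in> borel \<rightarrow>\<^sub>M borel"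
    and S: "\<And>i. i \<in> I \<Longrightarrow> finite (S i)" "\<And>i z. i \<in> I \<Longrightarrow> T i z \<in> S i"
    and near: "\<And>i y z. i \<in> I \<Longrightarrow> T i y \<noteq> T i z \<Longrightarrow> dist z (T i z) \<le> \<delta> i / 2"
  shows "J2 ({(discrete_kernel (T i) (\<delta> i) \<pi> \<eta>, discrete_measure (T i) \<pi>) | i. i \<in> I} \<union> {(\<eta>, \<pi>)})"
  unfolding J2_def
proof (intro allI impI conjI)
  let ?k = "\<lambda>i. discrete_kernel (T i) (\<delta> i) \<pi> \<eta>" and ?\<nu> = "\<lambda>i. discrete_measure (T i) \<pi>"
  let ?F = "{(?k i, ?\<nu> i) | i. i \<in> I}"
  fix f :: "'a \<Rightarrow> real" assume f: "continuous_on UNIV f \<and> bounded (range f)"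
  interpret prob_space \<pi> by fact
  obtain M where M: "0 \<le> M" "\<And>x. x \<in> msupport \<pi> \<Longrightarrow>
      (\<integral>\<^sup>+ y \<in> msupport \<pi>. ennreal (weighted_kernel \<eta> x y) \<partial>\<pi>) \<le> ennreal M"
    using J2_nn_integral_bound[OF J2 nonneg] by metis
  obtain K where K: "K > 0" "\<And>q. \<bar>f q\<bar> \<le> K" using f by (auto simp: bounded_pos)
  have fin: "finite (msupport (?\<nu> i))" if "i \<in> I" for i
    using msupport_discrete_measureD(1)[OF T[OF that] sets S(1)[OF that] S(2)[OF that]] S(1)[OF that]
    by (meson finite_subset subsetI)
  have orig: "\<forall>x\<in>msupport \<pi>. set_integrable \<pi> (msupport \<pi>) (\<lambda>y. f y * weighted_kernel \<eta> x y)"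
    "bounded (kernel_integral f \<eta> \<pi> ` msupport \<pi>)" "continuous_on (msupport \<pi>) (kernel_integral f \<eta> \<pi>)"
    "(SUP x\<in>msupport \<pi>. ereal (kernel_integral f \<eta> \<pi> x)) < \<infinity>"
    using J2 f unfolding J2_def by auto
  have disc: "(\<forall>x\<in>msupport (?\<nu> i). set_integrable (?\<nu> i) (msupport (?\<nu> i)) (\<lambda>y. f y * weighted_kernel (?k i) x y)) \<and>
    bounded (kernel_integral f (?k i) (?\<nu> i) ` msupport (?\<nu> i)) \<and>
    continuous_on (msupport (?\<nu> i)) (kernel_integral f (?k i) (?\<nu> i))" if i: "i \<in> I" for i
  proof (intro conjI ballI)
    have "T i \<in> \<pi> \<rightarrow>\<^sub>M borel" using T[OF i] by (simp add: measurable_cong_sets[OF sets])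
    then interpret D: prob_space "?\<nu> i" unfolding discrete_measure_def by (rule prob_space_distr)
    show "set_integrable (?\<nu> i) (msupport (?\<nu> i)) (\<lambda>y. f y * weighted_kernel (?k i) x y)" for x
      unfolding set_integrable_def real_scaleR_def
      using D.finite_measure_axioms fin[OF i]
      by (intro integrable_indicator_finite) (auto simp: discrete_measure_def)
    show "bounded (kernel_integral f (?k i) (?\<nu> i) ` msupport (?\<nu> i))"
      using fin[OF i] by (intro finite_imp_bounded finite_imageI)
    show "continuous_on (msupport (?\<nu> i)) (kernel_integral f (?k i) (?\<nu> i))"
      using fin[OF i] by (rule continuous_on_finite)
  qed
  show "\<forall>(\<eta>, \<pi>)\<in>?F \<union> {(\<eta>, \<pi>)}.
        (\<forall>x\<in>msupport \<pi>. set_integrable \<pi> (msupport \<pi>) (\<lambda>y. f y * weighted_kernel \<eta> x y)) \<and>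
        bounded (kernel_integral f \<eta> \<pi> ` msupport \<pi>) \<and>
        continuous_on (msupport \<pi>) (kernel_integral f \<eta> \<pi>)"
    using orig disc by blast
  have "(SUP (\<eta>, \<pi>)\<in>?F. SUP x\<in>msupport \<pi>. ereal (kernel_integral f \<eta> \<pi> x)) \<le> ereal (K * (9 * M))"
  proof (rule SUP_least)
    fix a assume "a \<in> ?F"
    then obtain i where i: "i \<in> I" "a = (?k i, ?\<nu> i)" by blast
    have "ereal (kernel_integral f (?k i) (?\<nu> i) p) \<le> ereal (K * (9 * M))" if "p \<in> msupport (?\<nu> i)" for p
    proof -
      have "\<bar>kernel_integral f (?k i) (?\<nu> i) p\<bar> \<le> K * (9 * M)"
        by (rule kernel_integral_discrete_kernel_bound[OF \<pi> sets nonneg T[OF i(1)] S(1)[OF i(1)]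
            S(2)[OF i(1)] _ that M less_imp_le[OF K(1)] K(2)])
          (assumption | rule near[OF i(1)])+
      then show ?thesis by simp
    qed
    then show "(case a of (\<eta>, \<pi>) \<Rightarrow> SUP x\<in>msupport \<pi>. ereal (kernel_integral f \<eta> \<pi> x)) \<le> ereal (K * (9 * M))"
      unfolding i(2) by (auto intro: SUP_least)
  qed
  also have "\<dots> < \<infinity>" by simp
  finally have "(SUP (\<eta>, \<pi>)\<in>?F. SUP x\<in>msupport \<pi>. ereal (kernel_integral f \<eta> \<pi> x)) < \<infinity>" .
  with orig(4) show
    "(SUP (\<eta>, \<pi>)\<in>?F \<union> {(\<eta>, \<pi>)}. SUP x\<in>msupport \<pi>. ereal (kernel_integral f \<eta> \<pi> x)) < \<infinity>"
    unfolding SUP_union sup_max max_less_iff_conj by simp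
qed

lemma J3_discretisation:
  fixes \<pi> :: "'a::{metric_space, second_countable_topology} measure" and T :: "'i \<Rightarrow> 'a \<Rightarrow> 'a"
  assumes \<pi>: "prob_space \<pi>" and sets: "sets \<pi> = sets borel"
    and nonneg: "\<And>y z. y \<noteq> z \<Longrightarrow> 0 \<le> \<eta> y z" and J3: "J3 {(\<eta>, \<pi>)}"
    and T: "\<And>i. i \<in> I \<Longrightarrow> T i \<in> borel \<rightarrow>\<^sub>M borel"
    and S: "\<And>i. i \<in> I \<Longrightarrow> finite (S i)" "\<And>i z. i \<in> I \<Longrightarrow> T i z \<in> S i"
    and near: "\<And>i y z. i \<in> I \<Longrightarrow> T i y \<noteq> T i z \<Longrightarrow> dist z (T i z) \<le> \<delta> i / 2"
    and sep: "\<And>i y z. i \<in> I \<Longrightarrow> T i y \<noteq> T i z \<Longrightarrow> dist z (T i z) \<le> c / 2 * dist (T i y) (T i z)"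
    and c: "0 \<le> c" and bdd: "bounded (UNIV :: 'a set)"
  shows "J3 ({(discrete_kernel (T i) (\<delta> i) \<pi> \<eta>, discrete_measure (T i) \<pi>) | i. i \<in> I} \<union> {(\<eta>, \<pi>)})"
proof -
  let ?k = "\<lambda>i. discrete_kernel (T i) (\<delta> i) \<pi> \<eta>" and ?\<nu> = "\<lambda>i. discrete_measure (T i) \<pi>"
  let ?F = "{(?k i, ?\<nu> i) | i. i \<in> I}"
  define tail where "tail = (\<lambda>R (\<eta>, \<pi> :: 'a measure). SUP x\<in>msupport \<pi>.
        \<integral>\<^sup>+ y \<in> msupport \<pi> \<inter> {y. dist x y < 1 / R \<or> dist x y > R}.
          ennreal (weighted_kernel \<eta> x y) \<partial>\<pi>)"
  define s where "s R = tail R (\<eta>, \<pi>)" for R :: real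
  have s: "(s \<longlongrightarrow> 0) at_top" using J3 by (simp add: J3_def s_def[abs_def] tail_def)
  obtain e where e: "\<And>x y :: 'a. dist x y \<le> e" using bdd by (meson UNIV_I bounded_two_points)
  have bound: "(SUP a\<in>?F. tail R a) \<le> 9 * s (R / (1 + c))" if R: "R > e" "R > 0" for R
  proof (rule SUP_least)
    fix a assume "a \<in> ?F"
    then obtain i where i: "i \<in> I" "a = (?k i, ?\<nu> i)" by blast
    let ?R = "R / (1 + c)"
    let ?C = "{(x, y). dist x y < 1 / ?R \<or> dist x y > ?R}"
    have "(\<integral>\<^sup>+ q \<in> msupport (?\<nu> i) \<inter> {q. dist p q < 1 / R \<or> dist p q > R}.
        ennreal (weighted_kernel (?k i) p q) \<partial>?\<nu> i) \<le> 9 * s ?R" if p: "p \<in> msupport (?\<nu> i)" for p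
    proof (rule nn_integral_discrete_kernel_le[where C = ?C, OF \<pi> sets nonneg T[OF i(1)] S(1)[OF i(1)] S(2)[OF i(1)]
          near[OF i(1)] p])
      fix x y assume xy: "T i x = p" "T i y \<noteq> p" "T i y \<in> {q. dist p q < 1 / R \<or> dist p q > R}"
      then have "dist p (T i y) < 1 / R" using e[of p "T i y"] R by auto
      moreover have "dist x y \<le> dist x (T i x) + dist p (T i y) + dist y (T i y)"
        using xy(1) dist_triangle[of x y p] dist_triangle[of p y "T i y"] by (simp add: dist_commute)
      moreover have "dist x (T i x) \<le> c / 2 * dist p (T i y)" "dist y (T i y) \<le> c / 2 * dist p (T i y)"
        using sep[OF i(1), of y x] sep[OF i(1), of x y] xy(1,2) by (auto simp: dist_commute)
      ultimately have "dist x y \<le> (1 + c) * dist p (T i y)" by (simp add: algebra_simps)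
      also have "\<dots> < (1 + c) * (1 / R)"
        using \<open>dist p (T i y) < 1 / R\<close> c by (intro mult_strict_left_mono) auto
      finally show "(x, y) \<in> ?C" by simp
    next
      fix x assume "x \<in> msupport \<pi>"
      then show "(\<integral>\<^sup>+ y \<in> msupport \<pi> \<inter> {y. (x, y) \<in> ?C}. ennreal (weighted_kernel \<eta> x y) \<partial>\<pi>) \<le> s ?R"
        unfolding s_def tail_def by (auto intro: SUP_upper2)
    qed
    then show "tail R a \<le> 9 * s ?R" unfolding i(2) tail_def by (auto intro: SUP_least)
  qed
  have "((\<lambda>R. 9 * s (R / (1 + c)) + s R) \<longlongrightarrow> 9 * 0 + 0) at_top"
  proof (intro tendsto_add s)
    have "filterlim (\<lambda>R. (1 / (1 + c)) * R) at_top at_top"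
      using c by (intro filterlim_tendsto_pos_mult_at_top[OF tendsto_const _ filterlim_ident]) simp
    then have "((\<lambda>R. s (R / (1 + c))) \<longlongrightarrow> 0) at_top"
      using filterlim_compose[OF s] by simp
    then show "((\<lambda>R. 9 * s (R / (1 + c))) \<longlongrightarrow> 9 * 0) at_top"
      by (intro ennreal_tendsto_cmult) simp_all
  qed
  then have lim: "((\<lambda>R. 9 * s (R / (1 + c)) + s R) \<longlongrightarrow> 0) at_top" by simp
  have ev: "\<forall>\<^sub>F R in at_top. (SUP a\<in>?F \<union> {(\<eta>, \<pi>)}. tail R a) \<le> 9 * s (R / (1 + c)) + s R"
    using eventually_gt_at_top[of e] eventually_gt_at_top[of 0]
  proof eventually_elim
    fix R assume "e < R" "0 < R"
    then show "(SUP a\<in>?F \<union> {(\<eta>, \<pi>)}. tail R a) \<le> 9 * s (R / (1 + c)) + s R"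
      using bound[of R] by (auto simp: SUP_union s_def intro: add_increasing add_increasing2)
  qed
  have "((\<lambda>R. SUP a\<in>?F \<union> {(\<eta>, \<pi>)}. tail R a) \<longlongrightarrow> 0) at_top"
    by (rule tendsto_sandwich[OF always_eventually ev tendsto_const lim]) (rule allI, rule zero_le)
  then show ?thesis by (simp add: J3_def tail_def)
qed

section \<open>Continuous extension of the discretised kernels\<close>

lemma open_off_diagonal: "open (off_diagonal :: ('a::t2_space \<times> 'a) set)"
  unfolding off_diagonal_def case_prod_beta
  by (rule open_Collect_neq) (intro continuous_intros)+

lemma discrete_kernel_approx:
  fixes \<pi> :: "'a::{metric_space, second_countable_topology} measure"
  assumes \<pi>: "prob_space \<pi>" and sets: "sets \<pi> = sets borel"
    and cont: "continuous_on off_diagonal (\<lambda>(y, z). \<eta> y z)"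
    and T: "T \<in> borel \<rightarrow>\<^sub>M borel" and "p \<noteq> q"
    and pos: "emeasure \<pi> (T -` {p}) > 0" "emeasure \<pi> (T -` {q}) > 0"
    and far: "\<And>x y. T x = p \<Longrightarrow> T y = q \<Longrightarrow> \<delta> / 2 \<le> dist x y"
    and osc: "\<And>x y. T x = p \<Longrightarrow> T y = q \<Longrightarrow> \<bar>\<eta> x y - v\<bar> \<le> \<epsilon>"
  shows "\<bar>discrete_kernel T \<delta> \<pi> \<eta> p q - v\<bar> \<le> \<epsilon>"
proof -
  interpret prob_space \<pi> by fact
  interpret P: pair_prob_space \<pi> \<pi> ..
  let ?P = "\<pi> \<Otimes>\<^sub>M \<pi>"
  have space: "space \<pi> = UNIV" using sets_eq_imp_space_eq[OF sets] by simp
  have T': "T \<in> \<pi> \<rightarrow>\<^sub>M borel" using T by (simp add: measurable_cong_sets[OF sets])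
  have cell: "T -` {r} \<in> sets \<pi>" for r
    using measurable_sets[OF T', of "{r}"] space by simp
  define m where "m r = measure \<pi> (T -` {r})" for r
  have m: "measure (discrete_measure T \<pi>) {r} = m r" for r
    using emeasure_discrete_measure[OF T sets, of "{r}"] by (simp add: measure_def m_def)
  have mpos: "m p > 0" "m q > 0" using pos by (simp_all add: m_def emeasure_eq_measure)
  define A where "A = (T -` {p}) \<times> (T -` {q})"
  have A: "A \<in> sets ?P" using cell by (simp add: A_def)
  have mA: "measure ?P A = m p * m q"
    using cell by (simp add: A_def m_def measure_def emeasure_pair_measure_Times enn2real_mult)
  have AG: "z \<in> off_diagonal" if "z \<in> A" for z
    using that \<open>p \<noteq> q\<close> by (auto simp: A_def off_diagonal_def)
  have setsP: "sets ?P = sets borel"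
    by (simp add: borel_prod[symmetric] sets_pair_measure_cong[OF sets sets])
  have "(\<lambda>z. indicator off_diagonal z *\<^sub>R (case z of (y, z) \<Rightarrow> \<eta> y z)) \<in> borel_measurable borel"
    using cont by (intro borel_measurable_continuous_on_indicator borel_open open_off_diagonal)
  then have "(\<lambda>z. indicator off_diagonal z *\<^sub>R (case z of (y, z) \<Rightarrow> \<eta> y z)) \<in> borel_measurable ?P"
    by (simp add: measurable_cong_sets[OF setsP])
  then have "(\<lambda>z. indicator A z * (indicator off_diagonal z *\<^sub>R (case z of (y, z) \<Rightarrow> \<eta> y z))) \<in> borel_measurable ?P"
    using A by (intro borel_measurable_times borel_measurable_indicator)
  moreover have "indicator A z * (indicator off_diagonal z *\<^sub>R (case z of (y, z) \<Rightarrow> \<eta> y z)) =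
      indicator A z * \<eta> (fst z) (snd z)" for z
    using AG[of z] by (auto simp: indicator_def case_prod_beta)
  ultimately have meas: "(\<lambda>z. indicator A z * \<eta> (fst z) (snd z)) \<in> borel_measurable ?P"
    by (simp only:)
  have osc': "\<bar>indicator A z * \<eta> (fst z) (snd z) - indicator A z * v\<bar> \<le> indicator A z * \<epsilon>" for z
    using osc by (auto simp: A_def indicator_def)
  have intA: "integrable ?P (\<lambda>z. indicator A z * c)" for c :: real
    using A by (intro integrable_mult_left integrable_real_indicator) (auto simp: P.emeasure_eq_measure)
  have int: "integrable ?P (\<lambda>z. indicator A z * \<eta> (fst z) (snd z))"
  proof (rule Bochner_Integration.integrable_bound[OF intA[of "\<bar>v\<bar> + \<epsilon>"] meas], rule AE_I2)
    show "norm (indicat_real A z * \<eta> (fst z) (snd z)) \<le> norm (indicat_real A z * (\<bar>v\<bar> + \<epsilon>))" for z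
      using osc'[of z] by (auto simp: indicator_def split: if_splits)
  qed
  let ?I = "\<integral>z. indicator A z * \<eta> (fst z) (snd z) \<partial>?P"
  have "discrete_kernel T \<delta> \<pi> \<eta> p q = 1 / (m p * m q) * ?I"
    unfolding discrete_kernel_def set_lebesgue_integral_def m
    using far by (intro arg_cong2[where f = "(*)"] refl Bochner_Integration.integral_cong)
      (auto simp: A_def indicator_def)
  then have "discrete_kernel T \<delta> \<pi> \<eta> p q - v = (?I - v * (m p * m q)) / (m p * m q)"
    using mpos by (simp add: field_simps)
  moreover have "\<bar>?I - v * (m p * m q)\<bar> \<le> \<epsilon> * (m p * m q)"
  proof -
    have val: "(\<integral>z. indicator A z * c \<partial>?P) = c * (m p * m q)" for c :: real
      using A mA by simp
    have "\<bar>?I - v * (m p * m q)\<bar> = \<bar>\<integral>z. indicator A z * \<eta> (fst z) (snd z) - indicator A z * v \<partial>?P\<bar>"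
      by (subst Bochner_Integration.integral_diff[OF int intA]) (simp only: val)
    also have "\<dots> \<le> (\<integral>z. \<bar>indicator A z * \<eta> (fst z) (snd z) - indicator A z * v\<bar> \<partial>?P)"
      by (rule integral_abs_bound)
    also have "\<dots> \<le> (\<integral>z. indicator A z * \<epsilon> \<partial>?P)"
      using int intA osc' by (intro integral_mono integrable_abs Bochner_Integration.integrable_diff)
    finally show ?thesis by (simp only: val)
  qed
  ultimately show ?thesis using mpos by (simp add: abs_mult pos_divide_le_eq)
qed

lemma sum_bumps_le_1:
  fixes S :: "'a::metric_space set"
  assumes "finite S" "s > 0" and sep: "\<And>p q. p \<in> S \<Longrightarrow> q \<in> S \<Longrightarrow> p \<noteq> q \<Longrightarrow> s \<le> dist p q"
  shows "(\<Sum>p\<in>S. max 0 (1 - 2 * dist x p / s)) \<le> 1"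
proof (cases "\<exists>p\<in>S. dist x p < s / 2")
  case True
  then obtain p where p: "p \<in> S" "dist x p < s / 2" by blast
  have "max 0 (1 - 2 * dist x q / s) = 0" if "q \<in> S - {p}" for q
  proof -
    have "s \<le> dist x p + dist x q" using sep[of p q] that p dist_triangle3[of p q x] by auto
    then show ?thesis using p \<open>s > 0\<close> by (simp add: field_simps)
  qed
  then have "(\<Sum>q\<in>S. max 0 (1 - 2 * dist x q / s)) = max 0 (1 - 2 * dist x p / s)"
    using p(1) assms(1) by (simp add: sum.remove)
  also have "\<dots> \<le> 1" using \<open>s > 0\<close> by simp
  finally show ?thesis .
next
  case False
  then have "max 0 (1 - 2 * dist x p / s) = 0" if "p \<in> S" for p
    using that \<open>s > 0\<close> by (auto simp: not_less field_simps)
  then show ?thesis by simp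
qed

definition bump_extension ::
  "real \<Rightarrow> 'a::metric_space set \<Rightarrow> ('a \<Rightarrow> 'a \<Rightarrow> real) \<Rightarrow> ('a \<Rightarrow> 'a \<Rightarrow> real) \<Rightarrow> 'a \<times> 'a \<Rightarrow> real"
  where "bump_extension s S k \<eta> z = max 0 (\<eta> (fst z) (snd z) +
    (\<Sum>p\<in>S. \<Sum>q\<in>S - {p}. (k p q - \<eta> p q) *
      (max 0 (1 - 2 * dist (fst z) p / s) * max 0 (1 - 2 * dist (snd z) q / s))))"

lemma continuous_on_bump_extension:
  assumes "continuous_on off_diagonal (\<lambda>(y, z). \<eta> y z)"
  shows "continuous_on off_diagonal (bump_extension s S k \<eta>)"
  using assms unfolding bump_extension_def[abs_def] case_prod_beta divide_inverse
  by (intro continuous_intros)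

lemma bump_extension_grid:
  assumes S: "finite S" "s > 0" and sep: "\<And>p q. p \<in> S \<Longrightarrow> q \<in> S \<Longrightarrow> p \<noteq> q \<Longrightarrow> s \<le> dist p q"
    and pq: "p \<in> S" "q \<in> S" "p \<noteq> q" and "0 \<le> k p q"
  shows "bump_extension s S k \<eta> (p, q) = k p q"
proof -
  have bump: "max 0 (1 - 2 * dist r r' / s) = (if r' = r then 1 else 0)" if "r \<in> S" "r' \<in> S" for r r'
    using sep[of r r'] that S(2) by (auto simp: field_simps)
  have "(\<Sum>p'\<in>S. \<Sum>q'\<in>S - {p'}. (k p' q' - \<eta> p' q') *
      (max 0 (1 - 2 * dist p p' / s) * max 0 (1 - 2 * dist q q' / s))) =
    (\<Sum>p'\<in>S. if p' = p then \<Sum>q'\<in>S - {p}. if q' = q then k p q - \<eta> p q else 0 else 0)"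
  proof (rule sum.cong[OF refl])
    fix p' assume p': "p' \<in> S"
    show "(\<Sum>q'\<in>S - {p'}. (k p' q' - \<eta> p' q') *
        (max 0 (1 - 2 * dist p p' / s) * max 0 (1 - 2 * dist q q' / s))) =
      (if p' = p then \<Sum>q'\<in>S - {p}. if q' = q then k p q - \<eta> p q else 0 else 0)"
    proof (cases "p' = p")
      case True
      have "(k p q' - \<eta> p q') * (max 0 (1 - 2 * dist p p / s) * max 0 (1 - 2 * dist q q' / s)) =
          (if q' = q then k p q - \<eta> p q else 0)" if "q' \<in> S - {p}" for q'
        unfolding bump[OF pq(1) pq(1)] using bump[OF pq(2), of q'] that by simp
      then show ?thesis unfolding True by (subst if_P[OF refl], intro sum.cong refl)
    next
      case False
      then show ?thesis using pq p' by (auto simp: bump intro!: sum.neutral)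
    qed
  qed
  also have "\<dots> = k p q - \<eta> p q" using S(1) pq by simp
  finally show ?thesis using \<open>0 \<le> k p q\<close> by (simp add: bump_extension_def)
qed

lemma bump_extension_approx:
  assumes S: "finite S" "s > 0" and sep: "\<And>p q. p \<in> S \<Longrightarrow> q \<in> S \<Longrightarrow> p \<noteq> q \<Longrightarrow> s \<le> dist p q"
    and "0 \<le> \<eta> x y" "0 \<le> \<epsilon>"
    and close: "\<And>p q. p \<in> S \<Longrightarrow> q \<in> S \<Longrightarrow> p \<noteq> q \<Longrightarrow> dist x p < s / 2 \<Longrightarrow> dist y q < s / 2 \<Longrightarrow>
      \<bar>k p q - \<eta> p q\<bar> \<le> \<epsilon>"
  shows "\<bar>bump_extension s S k \<eta> (x, y) - \<eta> x y\<bar> \<le> \<epsilon>"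
proof -
  let ?b = "\<lambda>x p. max 0 (1 - 2 * dist x p / s)"
  let ?E = "\<Sum>p\<in>S. \<Sum>q\<in>S - {p}. (k p q - \<eta> p q) * (?b x p * ?b y q)"
  have b0: "?b x p = 0" if "\<not> dist x p < s / 2" for x p :: 'a
    using that S(2) by (auto simp: not_less field_simps)
  have "\<bar>?E\<bar> \<le> (\<Sum>p\<in>S. \<bar>\<Sum>q\<in>S - {p}. (k p q - \<eta> p q) * (?b x p * ?b y q)\<bar>)"
    by (rule sum_abs)
  also have "\<dots> \<le> (\<Sum>p\<in>S. \<Sum>q\<in>S - {p}. \<bar>(k p q - \<eta> p q) * (?b x p * ?b y q)\<bar>)"
    by (intro sum_mono sum_abs)
  also have "\<dots> \<le> (\<Sum>p\<in>S. \<Sum>q\<in>S - {p}. \<epsilon> * (?b x p * ?b y q))"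
  proof (intro sum_mono)
    fix p q assume pq: "p \<in> S" "q \<in> S - {p}"
    show "\<bar>(k p q - \<eta> p q) * (?b x p * ?b y q)\<bar> \<le> \<epsilon> * (?b x p * ?b y q)"
    proof (cases "dist x p < s / 2 \<and> dist y q < s / 2")
      case True
      then have "\<bar>k p q - \<eta> p q\<bar> \<le> \<epsilon>" using close pq by auto
      moreover have "0 \<le> ?b x p * ?b y q" by (intro mult_nonneg_nonneg) simp_all
      ultimately show ?thesis by (simp only: abs_mult[of _ "?b x p * ?b y q"] abs_of_nonneg mult_right_mono)
    next
      case False
      then have "?b x p * ?b y q = 0" using b0 by auto
      then show ?thesis by (simp only: mult_zero_right abs_zero)
    qed
  qed
  also have "\<dots> \<le> (\<Sum>p\<in>S. \<Sum>q\<in>S. \<epsilon> * (?b x p * ?b y q))"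
    using S(1) \<open>0 \<le> \<epsilon>\<close> by (intro sum_mono sum_mono2 mult_nonneg_nonneg) auto
  also have "\<dots> = \<epsilon> * ((\<Sum>p\<in>S. ?b x p) * (\<Sum>q\<in>S. ?b y q))"
    by (subst sum_product) (simp only: sum_distrib_left)
  also have "\<dots> \<le> \<epsilon> * (1 * 1)"
    using \<open>0 \<le> \<epsilon>\<close> sum_bumps_le_1[OF S sep]
    by (intro mult_left_mono mult_mono sum_nonneg) auto
  finally have "\<bar>?E\<bar> \<le> \<epsilon>" by simp
  then show ?thesis using \<open>0 \<le> \<eta> x y\<close> by (simp add: bump_extension_def)
qed

lemma uniform_limit_bump_extension:
  fixes \<pi> :: "'a::{metric_space, second_countable_topology} measure"
    and T :: "nat \<Rightarrow> 'a \<Rightarrow> 'a" and s r \<delta> :: "nat \<Rightarrow> real"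
  assumes \<pi>: "prob_space \<pi>" and sets: "sets \<pi> = sets borel"
    and nonneg: "\<And>y z. y \<noteq> z \<Longrightarrow> 0 \<le> \<eta> y z"
    and cont: "continuous_on off_diagonal (\<lambda>(y, z). \<eta> y z)"
    and comp: "compact (UNIV :: 'a set)"
    and T: "\<And>m. T m \<in> borel \<rightarrow>\<^sub>M borel" and S: "\<And>m. finite (S m)" "\<And>m. s m > 0"
    and sep: "\<And>m p q. p \<in> S m \<Longrightarrow> q \<in> S m \<Longrightarrow> p \<noteq> q \<Longrightarrow> s m \<le> dist p q"
    and near: "\<And>m z. dist z (T m z) \<le> r m"
    and pos: "\<And>m p. p \<in> S m \<Longrightarrow> emeasure \<pi> (T m -` {p}) > 0"
    and lim: "s \<longlonglongrightarrow> 0" "r \<longlonglongrightarrow> 0" "\<delta> \<longlonglongrightarrow> 0"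
    and K: "compact K" "K \<subseteq> off_diagonal"
  shows "uniform_limit K (\<lambda>m. bump_extension (s m) (S m) (discrete_kernel (T m) (\<delta> m) \<pi> \<eta>) \<eta>)
    (\<lambda>(y, z). \<eta> y z) sequentially"
proof (rule uniform_limitI)
  fix \<epsilon> :: real assume "\<epsilon> > 0"
  let ?H = "\<lambda>m. bump_extension (s m) (S m) (discrete_kernel (T m) (\<delta> m) \<pi> \<eta>) \<eta>"
  obtain d where d: "d > 0" "\<And>x y. (x, y) \<in> K \<Longrightarrow> d \<le> dist x y"
  proof (cases "K = {}")
    case True
    then show ?thesis using that[of 1] by simp
  next
    case False
    have "continuous_on K (\<lambda>z. dist (fst z) (snd z))" by (intro continuous_intros)
    then obtain z where z: "z \<in> K" "\<And>z'. z' \<in> K \<Longrightarrow> dist (fst z) (snd z) \<le> dist (fst z') (snd z')"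
      using continuous_attains_inf[OF K(1) False] by blast
    have "fst z \<noteq> snd z" using z(1) K(2) by (auto simp: off_diagonal_def)
    then show ?thesis using that[of "dist (fst z) (snd z)"] z(2) by force
  qed
  define L where "L = {z :: 'a \<times> 'a. d / 2 \<le> dist (fst z) (snd z)}"
  have "closed L" unfolding L_def by (intro closed_Collect_le continuous_intros)
  moreover have "compact (UNIV :: ('a \<times> 'a) set)" using compact_Times[OF comp comp] by simp
  ultimately have "compact L" using compact_Int_closed[of UNIV L] by simp
  moreover have "L \<subseteq> off_diagonal" using d(1) by (auto simp: L_def off_diagonal_def)
  ultimately have "uniformly_continuous_on L (\<lambda>(y, z). \<eta> y z)"
    using cont by (intro compact_uniformly_continuous) (auto intro: continuous_on_subset)
  then obtain \<tau> where \<tau>: "\<tau> > 0" "\<And>z z'. z \<in> L \<Longrightarrow> z' \<in> L \<Longrightarrow> dist z' z < \<tau> \<Longrightarrow>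
      dist (case z' of (y, z) \<Rightarrow> \<eta> y z) (case z of (y, z) \<Rightarrow> \<eta> y z) < \<epsilon> / 2"
    using \<open>\<epsilon> > 0\<close> unfolding uniformly_continuous_on_def by (meson half_gt_zero)
  have "\<forall>\<^sub>F m in sequentially. s m < d / 8 \<and> r m < d / 8 \<and> r m < \<tau> / 2 \<and> \<delta> m < d / 8"
    using order_tendstoD(2)[OF lim(1), of "d / 8"] order_tendstoD(2)[OF lim(2), of "d / 8"]
      order_tendstoD(2)[OF lim(2), of "\<tau> / 2"] order_tendstoD(2)[OF lim(3), of "d / 8"] d \<tau>
    by (intro eventually_conj) simp_all
  then show "\<forall>\<^sub>F m in sequentially. \<forall>z\<in>K. dist (?H m z) (case z of (y, z) \<Rightarrow> \<eta> y z) < \<epsilon>"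
  proof eventually_elim
    fix m assume "s m < d / 8 \<and> r m < d / 8 \<and> r m < \<tau> / 2 \<and> \<delta> m < d / 8"
    then have m: "s m < d / 8" "r m < d / 8" "r m < \<tau> / 2" "\<delta> m < d / 8" by simp_all
    have "\<bar>?H m (x, y) - \<eta> x y\<bar> \<le> \<epsilon> / 2" if xy: "(x, y) \<in> K" for x y
    proof (rule bump_extension_approx[OF S(1)[of m] S(2)[of m]])
      show "s m \<le> dist p q" if "p \<in> S m" "q \<in> S m" "p \<noteq> q" for p q using that by (rule sep)
      show "0 \<le> \<eta> x y" by (rule nonneg) (use d xy in force)
      show "0 \<le> \<epsilon> / 2" using \<open>\<epsilon> > 0\<close> by simp
      fix p q assume pq: "p \<in> S m" "q \<in> S m" "p \<noteq> q" "dist x p < s m / 2" "dist y q < s m / 2"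
      have dpq: "d - s m \<le> dist p q"
        using d(2)[OF xy] pq dist_triangle[of x y p] dist_triangle[of p y q] by (simp add: dist_commute)
      have cells: "d / 2 \<le> dist x' y' \<and> dist (x', y') (p, q) < \<tau>" if "T m x' = p" "T m y' = q" for x' y'
      proof -
        have r: "dist x' p \<le> r m" "dist y' q \<le> r m" using near[where m = m] that by metis+
        have "dist p q \<le> dist x' p + dist x' y' + dist y' q"
          using dist_triangle[of p q x'] dist_triangle[of x' q y'] by (simp add: dist_commute)
        then have "d / 2 \<le> dist x' y'" using dpq r m d(1) by linarith
        moreover have "dist (x', y') (p, q) \<le> dist x' p + dist y' q"
          by (simp add: dist_Pair_Pair sqrt_sum_squares_le_sum)
        ultimately show ?thesis using r m by linarith
      qed
      have "(p, q) \<in> L" using dpq m d(1) by (simp add: L_def)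
      show "\<bar>discrete_kernel (T m) (\<delta> m) \<pi> \<eta> p q - \<eta> p q\<bar> \<le> \<epsilon> / 2"
      proof (rule discrete_kernel_approx[OF \<pi> sets cont T \<open>p \<noteq> q\<close> pos pos])
        show "p \<in> S m" "q \<in> S m" by fact+
        fix x' y' assume T': "T m x' = p" "T m y' = q"
        show "\<delta> m / 2 \<le> dist x' y'" using cells[OF T'] m d(1) by linarith
        have "(x', y') \<in> L" using cells[OF T'] by (simp add: L_def)
        then show "\<bar>\<eta> x' y' - \<eta> p q\<bar> \<le> \<epsilon> / 2"
          using \<tau>(2)[OF \<open>(p, q) \<in> L\<close>, of "(x', y')"] cells[OF T'] by (simp add: dist_real_def)
      qed
    qed
    then show "\<forall>z\<in>K. dist (?H m z) (case z of (y, z) \<Rightarrow> \<eta> y z) < \<epsilon>"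
      using \<open>\<epsilon> > 0\<close> by (force simp: dist_real_def)
  qed
qed

section \<open>Grids on the torus\<close>

lemma torus_cases:
  fixes z :: "'d::finite torus"
  obtains x where "z = to_torus x"
proof -
  have "\<exists>x. z = to_torus x" by (induction z rule: torus.abs_induct) auto
  then show ?thesis using that by blast
qed

lemma to_torus_eq_iff: "to_torus x = to_torus y \<longleftrightarrow> x - y \<in> int_lattice"
  by (rule torus.abs_eq_iff)

lemma dist_to_torus_attained:
  obtains k where "k \<in> int_lattice" "dist (to_torus x) (to_torus y) = norm (x - y - k)"
  using infdist_attains_inf[OF closed_int_lattice int_lattice_nonempty, of "x - y"]
  by (metis dist_norm dist_torus.abs_eq)

lemma norm_const_vec: "norm ((\<chi> i. t) :: real ^ 'd::finite) = \<bar>t\<bar> * sqrt (real CARD('d))"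
  by (simp add: norm_vec_def L2_set_def real_sqrt_mult)

lemma norm_le_sqrt_card:
  fixes v :: "real ^ 'd::finite"
  assumes "\<And>i. \<bar>v $ i\<bar> \<le> c"
  shows "norm v \<le> c * sqrt (real CARD('d))"
proof -
  have "0 \<le> c" using assms[of undefined] by linarith
  moreover have "norm v \<le> norm ((\<chi> i. c) :: real ^ 'd)"
    using assms \<open>0 \<le> c\<close> by (intro norm_le_componentwise_cart) simp
  ultimately show ?thesis by (simp add: norm_const_vec)
qed

lemma infdist_lattice_short:
  fixes r :: "real ^ 'd::finite"
  assumes "\<And>i. \<bar>r $ i\<bar> \<le> 1 / 2"
  shows "infdist r int_lattice = norm r"
proof (rule antisym)
  show "infdist r int_lattice \<le> norm r"
    using infdist_le[OF int_lattice_zero, of r] by simp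
  have "norm r \<le> dist r k" if k: "k \<in> int_lattice" for k
    unfolding dist_norm
  proof (rule norm_le_componentwise_cart)
    fix i
    have "k $ i \<in> \<int>" using k by (simp add: int_lattice_def)
    then have "k $ i = 0 \<or> \<bar>k $ i\<bar> \<ge> 1" using Ints_nonzero_abs_ge1 by blast
    then show "norm (r $ i) \<le> norm ((r - k) $ i)" using assms[of i] by auto
  qed
  then show "norm r \<le> infdist r int_lattice"
    unfolding infdist_notempty[OF int_lattice_nonempty]
    by (intro cINF_greatest int_lattice_nonempty)
qed

lemma compact_torus: "compact (UNIV :: 'd::finite torus set)"
proof -
  have "\<exists>x \<in> cbox 0 (\<chi> i. 1). z = to_torus x" for z :: "'d torus"
  proof -
    obtain y where y: "z = to_torus y" by (rule torus_cases)
    have "y - (\<chi> i. frac (y $ i)) \<in> int_lattice"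
      by (simp add: int_lattice_def frac_def)
    then have "z = to_torus (\<chi> i. frac (y $ i))" by (simp add: y to_torus_eq_iff)
    moreover have "(\<chi> i. frac (y $ i)) \<in> cbox 0 (\<chi> i. 1)"
      by (simp add: mem_box_cart frac_lt_1 less_imp_le)
    ultimately show ?thesis by blast
  qed
  then have "UNIV = to_torus ` cbox (0 :: real ^ 'd) (\<chi> i. 1)" by auto
  then show ?thesis
    using compact_continuous_image[OF continuous_on_to_torus compact_cbox] by metis
qed

lemma torus_bounded: "bounded (A :: 'd::finite torus set)"
  using compact_imp_bounded[OF compact_torus] bounded_subset by blast

instance torus :: (finite) second_countable_topology
proof
  obtain D :: "(real ^ 'a) set" where D: "countable D" "\<And>U. open U \<Longrightarrow> U \<noteq> {} \<Longrightarrow> \<exists>d\<in>D. d \<in> U"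
    using countable_dense_setE by blast
  define B where "B = (\<lambda>(d, r). ball (to_torus d) r) ` (D \<times> \<rat>)"
  have "topological_basis B"
  proof (rule topological_basisI)
    show "open B'" if "B' \<in> B" for B' using that by (auto simp: B_def)
    fix U and z :: "'a torus" assume U: "open U" "z \<in> U"
    then obtain e where e: "e > 0" "ball z e \<subseteq> U" using open_contains_ball by blast
    obtain r where r: "r \<in> \<rat>" "0 < r" "r < e / 2" using Rats_dense_in_real[of 0 "e / 2"] e by auto
    obtain x where x: "z = to_torus x" by (rule torus_cases)
    obtain d where d: "d \<in> D" "dist x d < r" using D(2)[of "ball x r"] r by auto
    have zd: "dist z (to_torus d) < r" using dist_to_torus_le[of x d] d x by simp
    have "ball (to_torus d) r \<subseteq> ball z e"
    proof
      fix y assume "y \<in> ball (to_torus d) r"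
      then show "y \<in> ball z e" using dist_triangle[of z y "to_torus d"] zd r by simp
    qed
    moreover have "ball (to_torus d) r \<in> B" using d r by (force simp: B_def)
    moreover have "z \<in> ball (to_torus d) r" using zd by (simp add: dist_commute)
    ultimately show "\<exists>B'\<in>B. z \<in> B' \<and> B' \<subseteq> U"
      using e(2) by (intro bexI[of _ "ball (to_torus d) r"]) auto
  qed
  moreover have "countable B" using D countable_rat by (auto simp: B_def)
  ultimately show "\<exists>B :: 'a torus set set. countable B \<and> open = generate_topology B"
    using topological_basis_imp_subbasis by blast
qed

lemma grid_rep_diff:
  fixes p q :: "'d::finite torus"
  assumes S: "evenly_spaced_grid n S" and n: "n > 0" and pq: "p \<in> S" "q \<in> S" "p \<noteq> q"
    and p: "p = to_torus y"
  obtains v where "v \<in> int_lattice" "v \<noteq> 0"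
    "dist (to_torus (y + u)) q = norm (u + (1 / real n) *\<^sub>R v)"
proof -
  obtain a where a: "S = {to_torus (a + (1 / real n) *\<^sub>R k) | k. k \<in> int_lattice}"
    using S by (auto simp: evenly_spaced_grid_def)
  obtain k l where kl: "k \<in> int_lattice" "l \<in> int_lattice"
    "p = to_torus (a + (1 / real n) *\<^sub>R k)" "q = to_torus (a + (1 / real n) *\<^sub>R l)"
    using pq a by auto
  define j where "j = y - (a + (1 / real n) *\<^sub>R k)"
  have j: "j \<in> int_lattice" using kl(3) p by (simp add: j_def to_torus_eq_iff[symmetric])
  obtain m where m: "m \<in> int_lattice"
    "dist (to_torus (y + u)) q = norm (y + u - (a + (1 / real n) *\<^sub>R l) - m)"
    unfolding kl by (rule dist_to_torus_attained)
  define v where "v = k - l + real n *\<^sub>R (j - m)"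
  have eq: "(1 / real n) *\<^sub>R v = (1 / real n) *\<^sub>R k - (1 / real n) *\<^sub>R l + (j - m)"
    using n by (simp add: v_def algebra_simps)
  have "v \<in> int_lattice"
    using kl(1,2) j m(1) by (auto simp: v_def int_lattice_def)
  moreover have "v \<noteq> 0"
  proof
    assume "v = 0"
    then have "y - (a + (1 / real n) *\<^sub>R l) = m"
      using eq by (simp add: j_def algebra_simps)
    then have "p = q" using m(1) unfolding p kl(4) by (simp add: to_torus_eq_iff)
    then show False using pq by blast
  qed
  moreover have "y + u - (a + (1 / real n) *\<^sub>R l) - m = u + (1 / real n) *\<^sub>R v"
    unfolding eq by (simp add: j_def algebra_simps)
  ultimately show ?thesis using that m(2) by metis
qed

lemma int_lattice_nonzero_component:
  assumes "v \<in> int_lattice" "v \<noteq> 0"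
  obtains i where "1 \<le> \<bar>v $ i\<bar>"
proof -
  obtain i where "v $ i \<noteq> 0" using assms(2) by (auto simp: vec_eq_iff)
  moreover have "v $ i \<in> \<int>" using assms(1) by (simp add: int_lattice_def)
  ultimately show ?thesis using that Ints_nonzero_abs_ge1 by blast
qed

lemma grid_separated:
  fixes p q :: "'d::finite torus"
  assumes "evenly_spaced_grid n S" "n > 0" "p \<in> S" "q \<in> S" "p \<noteq> q"
  shows "1 / real n \<le> dist p q"
proof -
  obtain y where y: "p = to_torus y" by (rule torus_cases)
  obtain v :: "real ^ 'd"
    where v: "v \<in> int_lattice" "v \<noteq> 0" "dist p q = norm (0 + (1 / real n) *\<^sub>R v)"
    using grid_rep_diff[OF assms y, of 0] y by (metis add.right_neutral)
  obtain i where "1 \<le> \<bar>v $ i\<bar>" using v int_lattice_nonzero_component by blast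
  then have "1 \<le> norm v" using component_le_norm_cart[of v i] by linarith
  then show ?thesis using assms(2) v(3) by (simp add: divide_right_mono)
qed

lemma grid_dense:
  fixes z :: "'d::finite torus"
  assumes "evenly_spaced_grid n S" "n > 0"
  obtains p where "p \<in> S" "dist z p \<le> sqrt (real CARD('d)) / (2 * real n)"
proof -
  obtain a where a: "S = {to_torus (a + (1 / real n) *\<^sub>R k) | k. k \<in> int_lattice}"
    using assms by (auto simp: evenly_spaced_grid_def)
  obtain y where y: "z = to_torus y" by (rule torus_cases)
  define k :: "real ^ 'd" where "k = (\<chi> i. of_int (round (real n * (y $ i - a $ i))))"
  define p where "p = to_torus (a + (1 / real n) *\<^sub>R k)"
  have "k \<in> int_lattice" by (simp add: k_def int_lattice_def)
  then have "p \<in> S" using a p_def by auto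
  moreover have "dist z p \<le> sqrt (real CARD('d)) / (2 * real n)"
  proof -
    have comp: "\<bar>(y - (a + (1 / real n) *\<^sub>R k)) $ i\<bar> \<le> 1 / (2 * real n)" for i
    proof -
      have "\<bar>of_int (round (real n * (y $ i - a $ i))) - real n * (y $ i - a $ i)\<bar> \<le> 1 / 2"
        by (rule of_int_round_abs_le)
      then have "\<bar>real n * (y - (a + (1 / real n) *\<^sub>R k)) $ i\<bar> \<le> 1 / 2"
        using assms(2) by (simp add: k_def algebra_simps abs_minus_commute)
      then have "real n * \<bar>(y - (a + (1 / real n) *\<^sub>R k)) $ i\<bar> \<le> 1 / 2" by (simp only: abs_mult abs_of_nat)
      then show ?thesis using assms(2) by (simp add: pos_le_divide_eq mult.commute)
    qed
    have "dist z p \<le> norm (y - (a + (1 / real n) *\<^sub>R k))"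
      using dist_to_torus_le by (simp add: y p_def flip: dist_norm)
    also have "\<dots> \<le> 1 / (2 * real n) * sqrt (real CARD('d))"
      using comp by (rule norm_le_sqrt_card)
    finally show ?thesis by simp
  qed
  ultimately show ?thesis using that by blast
qed

lemma dist_nearest_grid_point_le:
  fixes z :: "'d::finite torus"
  assumes "evenly_spaced_grid n S" "n > 0" "nearest_point_map S T"
  shows "dist z (T z) \<le> sqrt (real CARD('d)) / (2 * real n)"
proof -
  obtain p where "p \<in> S" "dist z p \<le> sqrt (real CARD('d)) / (2 * real n)"
    using grid_dense[OF assms(1,2)] .
  moreover from this have "dist z (T z) \<le> dist z p" using assms(3) by (simp add: nearest_point_map_def)
  ultimately show ?thesis by simp
qed

lemma ball_subset_cell:
  assumes "evenly_spaced_grid n S" "n > 0" "nearest_point_map S T" "p \<in> S"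
  shows "ball p (1 / (2 * real n)) \<subseteq> T -` {p}"
proof
  fix z assume z: "z \<in> ball p (1 / (2 * real n))"
  have T: "T z \<in> S" "dist z (T z) \<le> dist z p" using assms(3,4) by (auto simp: nearest_point_map_def)
  have "T z = p"
  proof (rule ccontr)
    assume "T z \<noteq> p"
    then have "1 / real n \<le> dist (T z) p" using grid_separated[OF assms(1,2) T(1) assms(4)] by simp
    also have "\<dots> \<le> dist z (T z) + dist z p" by (simp add: dist_triangle3)
    also have "\<dots> < 1 / (2 * real n) + 1 / (2 * real n)" using T z by (simp add: dist_commute)
    finally show False by simp
  qed
  then show "z \<in> T -` {p}" by simp
qed

lemma diagonal_shift_in_cell:
  fixes y :: "real ^ 'd::finite"
  assumes S: "evenly_spaced_grid n S" "n > 0" and T: "nearest_point_map S T"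
    and p: "to_torus y \<in> S" and t: "\<bar>t\<bar> < 1 / (2 * real n)"
  shows "T (to_torus (y + (\<chi> i. t))) = to_torus y"
proof (rule ccontr)
  let ?u = "(\<chi> i. t) :: real ^ 'd" and ?p = "to_torus y"
  let ?z = "to_torus (y + ?u)"
  assume ne: "T ?z \<noteq> ?p"
  have Tz: "T ?z \<in> S" "dist ?z (T ?z) \<le> dist ?z ?p" using T p by (auto simp: nearest_point_map_def)
  obtain v where v: "v \<in> int_lattice" "v \<noteq> 0"
    "dist ?z (T ?z) = norm (?u + (1 / real n) *\<^sub>R v)"
    using grid_rep_diff[OF S p Tz(1) ne[symmetric] refl, of ?u] by blast
  obtain i where i: "1 \<le> \<bar>v $ i\<bar>" using v int_lattice_nonzero_component by blast
  have big: "\<bar>t\<bar> < \<bar>t + v $ j / real n\<bar>" if "1 \<le> \<bar>v $ j\<bar>" for j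
  proof -
    have "1 / real n \<le> \<bar>v $ j / real n\<bar>" using that S(2) by (simp add: divide_right_mono)
    then show ?thesis using t by (simp add: field_simps)
  qed
  have le: "\<bar>t\<bar> \<le> \<bar>t + v $ j / real n\<bar>" for j
  proof (cases "v $ j = 0")
    case False
    moreover have "v $ j \<in> \<int>" using v(1) by (simp add: int_lattice_def)
    ultimately show ?thesis using big[of j] Ints_nonzero_abs_ge1 by fastforce
  qed simp
  have "(\<Sum>j\<in>(UNIV :: 'd set). t\<^sup>2) < (\<Sum>j\<in>UNIV. (t + v $ j / real n)\<^sup>2)"
  proof (rule sum_strict_mono_ex1)
    show "\<forall>j\<in>UNIV. t\<^sup>2 \<le> (t + v $ j / real n)\<^sup>2" using le by (simp flip: abs_le_square_iff)
    show "\<exists>j\<in>UNIV. t\<^sup>2 < (t + v $ j / real n)\<^sup>2" using power2_strict_mono[OF big[OF i]] by blast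
  qed simp
  then have "norm ?u < norm (?u + (1 / real n) *\<^sub>R v)"
    by (simp add: norm_vec_def L2_set_def)
  moreover have "dist ?z ?p \<le> norm ?u"
    using dist_to_torus_le[of "y + ?u" y] by (simp add: dist_norm)
  ultimately show False using Tz(2) v(3) by linarith
qed

lemma diameter_cell:
  fixes p :: "'d::finite torus"
  assumes S: "evenly_spaced_grid n S" "n \<ge> 2" and T: "nearest_point_map S T" and p: "p \<in> S"
  shows "diameter (T -` {p}) = sqrt (real CARD('d)) / real n"
proof (rule antisym)
  have n: "n > 0" using S by simp
  have "p \<in> T -` {p}" using n by (intro subsetD[OF ball_subset_cell[OF S(1) n T p]]) simp
  moreover have "dist y z \<le> sqrt (real CARD('d)) / real n" if "T y = p" "T z = p" for y z
  proof -
    have "dist y z \<le> dist y (T y) + dist z (T z)" using that by (simp add: dist_triangle2)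
    then show ?thesis
      using dist_nearest_grid_point_le[OF S(1) n T, of y] dist_nearest_grid_point_le[OF S(1) n T, of z]
      by (simp add: field_simps)
  qed
  ultimately show "diameter (T -` {p}) \<le> sqrt (real CARD('d)) / real n"
    unfolding diameter_def by (subst if_not_P, blast, intro cSUP_least) auto
  show "sqrt (real CARD('d)) / real n \<le> diameter (T -` {p})"
  proof (rule dense_le)
    fix c assume c: "c < sqrt (real CARD('d)) / real n"
    show "c \<le> diameter (T -` {p})"
    proof (cases "c \<le> 0")
      case True
      then show ?thesis using diameter_ge_0[OF torus_bounded] by (rule order_trans)
    next
      case False
      obtain y where y: "p = to_torus y" by (rule torus_cases)
      define t where "t = c / (2 * sqrt (real CARD('d)))"
      have t: "0 < t" "t < 1 / (2 * real n)"
        using c False n by (simp_all add: t_def field_simps)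
      let ?u = "\<lambda>s. (\<chi> i. s) :: real ^ 'd"
      have "to_torus (y + ?u s) \<in> T -` {p}" if "\<bar>s\<bar> \<le> t" for s
        using diagonal_shift_in_cell[OF S(1) n T, of y s] that t p y by simp
      from diameter_bounded_bound[OF torus_bounded this[of t] this[of "- t"]]
      have "dist (to_torus (y + ?u t)) (to_torus (y + ?u (- t))) \<le> diameter (T -` {p})"
        using t by simp
      moreover have "dist (to_torus (y + ?u t)) (to_torus (y + ?u (- t))) = infdist (?u (2 * t)) int_lattice"
      proof -
        have "(y + ?u t) - (y + ?u (- t)) = ?u (2 * t)" by (simp add: vec_eq_iff)
        then show ?thesis by (simp add: dist_torus.abs_eq)
      qed
      moreover have "infdist (?u (2 * t)) int_lattice = norm (?u (2 * t))"
      proof (rule infdist_lattice_short)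
        have "1 / (2 * real n) \<le> 1 / 4" using S(2) by (simp add: field_simps)
        then show "\<bar>?u (2 * t) $ i\<bar> \<le> 1 / 2" for i using t by simp
      qed
      moreover have "norm (?u (2 * t)) = c" using t(1) by (simp add: norm_const_vec) (simp add: t_def)
      ultimately show ?thesis by simp
    qed
  qed
qed

lemma emeasure_torus_lebesgue:
  fixes A :: "'d::finite torus set"
  assumes "A \<in> sets borel"
  shows "emeasure torus_lebesgue A =
    emeasure lborel (to_torus -` A \<inter> {x :: real ^ 'd. \<forall>i. 0 \<le> x $ i \<and> x $ i < 1})"
proof -
  let ?Q = "{x :: real ^ 'd. \<forall>i. 0 \<le> x $ i \<and> x $ i < 1}"
  have Q: "?Q \<in> sets lborel" by measurable
  have "to_torus \<in> restrict_space lborel ?Q \<rightarrow>\<^sub>M borel"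
    by (rule measurable_restrict_space1) (use borel_measurable_to_torus in simp)
  then have "emeasure torus_lebesgue A = emeasure (restrict_space lborel ?Q) (to_torus -` A \<inter> ?Q)"
    using assms by (simp add: torus_lebesgue_def emeasure_distr space_restrict_space)
  then show ?thesis using Q by (simp add: emeasure_restrict_space)
qed

lemma emeasure_torus_lebesgue_pos:
  fixes U :: "'d::finite torus set"
  assumes "open U" "U \<noteq> {}"
  shows "emeasure torus_lebesgue U > 0"
proof -
  let ?Q = "{x :: real ^ 'd. \<forall>i. 0 \<le> x $ i \<and> x $ i < 1}"
  let ?V = "to_torus -` U \<inter> box 0 (\<chi> i. 1)"
  have Q: "?Q \<in> sets borel" by measurable
  have open_pre: "open (to_torus -` U)"
    using continuous_on_to_torus assms(1) by (metis open_vimage)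
  obtain z where "z \<in> U" using assms by blast
  obtain y where y: "z = to_torus y" by (rule torus_cases)
  define y' where "y' = (\<chi> i. frac (y $ i))"
  have "y - y' \<in> int_lattice" by (simp add: y'_def int_lattice_def frac_def)
  then have z: "z = to_torus y'" by (simp add: y to_torus_eq_iff)
  have "box (0 :: real ^ 'd) (\<chi> i. 1) \<noteq> {}" by (simp add: interval_ne_empty_cart)
  then have "y' \<in> closure (box 0 (\<chi> i. 1))"
    by (simp add: y'_def mem_box_cart frac_lt_1 less_imp_le)
  moreover have "y' \<in> to_torus -` U" using z \<open>z \<in> U\<close> by simp
  ultimately have ne: "?V \<noteq> {}" using open_pre by (metis disjoint_iff open_Int_closure_eq_empty)
  have V: "open ?V" using open_pre by (intro open_Int open_box)
  have "?V \<notin> null_sets lborel"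
    using open_not_negligible[OF V ne] null_sets_completionI[of ?V lborel]
    by (auto simp: negligible_iff_null_sets)
  then have "0 < emeasure lborel ?V"
    using V by (auto simp: null_sets_def zero_less_iff_neq_zero)
  also have "\<dots> \<le> emeasure lborel (to_torus -` U \<inter> ?Q)"
  proof (rule emeasure_mono)
    show "?V \<subseteq> to_torus -` U \<inter> ?Q" by (auto simp: mem_box_cart less_imp_le)
    have "to_torus -` U \<in> sets borel" using open_pre by simp
    then show "to_torus -` U \<inter> ?Q \<in> sets lborel" using Q by simp
  qed
  also have "\<dots> = emeasure torus_lebesgue U"
    using assms(1) by (simp add: emeasure_torus_lebesgue)
  finally show ?thesis .
qed

lemma finite_measure_torus_lebesgue: "finite_measure (torus_lebesgue :: 'd::finite torus measure)"
proof
  let ?Q = "{x :: real ^ 'd. \<forall>i. 0 \<le> x $ i \<and> x $ i < 1}"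
  have "emeasure (torus_lebesgue :: 'd torus measure) UNIV = emeasure lborel ?Q"
    by (subst emeasure_torus_lebesgue) simp_all
  also have "\<dots> \<le> emeasure lborel (cbox 0 (\<chi> i. 1) :: (real ^ 'd) set)"
    by (intro emeasure_mono) (auto simp: mem_box_cart less_imp_le)
  also have "\<dots> < \<infinity>" by (simp add: emeasure_lborel_cbox_eq)
  finally show "emeasure (torus_lebesgue :: 'd torus measure) (space torus_lebesgue) \<noteq> \<infinity>"
    by (simp add: torus_lebesgue_def)
qed

lemma emeasure_pos_of_RN_deriv_ge:
  fixes \<pi> :: "'d::finite torus measure"
  assumes "sets \<pi> = sets borel" "absolutely_continuous torus_lebesgue \<pi>" "c > 0"
    and c: "AE z in torus_lebesgue. ennreal c \<le> RN_deriv torus_lebesgue \<pi> z"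
    and U: "open U" "U \<noteq> {}"
  shows "emeasure \<pi> U > 0"
proof -
  interpret finite_measure "torus_lebesgue :: 'd torus measure"
    by (rule finite_measure_torus_lebesgue)
  have sets: "sets (torus_lebesgue :: 'd torus measure) = sets borel" by (simp add: torus_lebesgue_def)
  have "0 < ennreal c * emeasure torus_lebesgue U"
    using emeasure_torus_lebesgue_pos[OF U] \<open>c > 0\<close> by (simp add: ennreal_zero_less_mult_iff)
  also have "\<dots> = (\<integral>\<^sup>+ z. ennreal c * indicator U z \<partial>torus_lebesgue)"
    using U sets by (simp add: nn_integral_cmult_indicator)
  also have "\<dots> \<le> (\<integral>\<^sup>+ z. RN_deriv torus_lebesgue \<pi> z * indicator U z \<partial>torus_lebesgue)"
    using c by (intro nn_integral_mono_AE) (auto simp: indicator_def)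
  also have "\<dots> = emeasure (density torus_lebesgue (RN_deriv torus_lebesgue \<pi>)) U"
    using U sets by (subst emeasure_density) auto
  also have "density torus_lebesgue (RN_deriv torus_lebesgue \<pi>) = \<pi>"
    using assms sets by (intro density_RN_deriv) auto
  finally show ?thesis .
qed

section \<open>The discretised family on the torus\<close>

theorem proposition33:
  fixes \<pi> :: "'d::finite torus measure"
    and \<eta> :: "'d torus \<Rightarrow> 'd torus \<Rightarrow> real"
    and N :: "nat set"
    and x :: "nat \<Rightarrow> nat \<Rightarrow> 'd torus"
    and X :: "nat \<Rightarrow> 'd torus set"
    and T :: "nat \<Rightarrow> 'd torus \<Rightarrow> 'd torus"
    and \<delta> :: "nat \<Rightarrow> real"
    and \<pi>n :: "nat \<Rightarrow> 'd torus measure"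
    and \<eta>n :: "nat \<Rightarrow> 'd torus \<Rightarrow> 'd torus \<Rightarrow> real"
  assumes "prob_space \<pi>" and "sets \<pi> = sets borel"
    and "\<And>y z. y \<noteq> z \<Longrightarrow> 0 \<le> \<eta> y z"
    and "J1 {(\<eta>, \<pi>)}" and "J2 {(\<eta>, \<pi>)}" and "J3 {(\<eta>, \<pi>)}"
    and N_def: "N = range (\<lambda>m. 2 ^ m)"
    and X_def: "\<And>n. X n = x n ` {1..n ^ CARD('d)}"
    and "\<And>n. n \<in> N \<Longrightarrow> evenly_spaced_grid n (X n)"
    and "\<And>m n. m \<in> N \<Longrightarrow> n \<in> N \<Longrightarrow> m \<le> n \<Longrightarrow> X m \<subseteq> X n"
    and "\<And>n. n \<in> N \<Longrightarrow> nearest_point_map (X n) (T n)"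
    and \<delta>_def: "\<And>n. \<delta> n = diameter (T n -` {x n 1})"
    and \<pi>n_def: "\<And>n. \<pi>n n = discrete_measure (T n) \<pi>"
    and \<eta>n_def: "\<And>n. \<eta>n n = discrete_kernel (T n) (\<delta> n) \<pi> \<eta>"
  shows "(\<forall>n\<in>N. \<forall>j\<in>{1..n ^ CARD('d)}. diameter (T n -` {x n j}) = \<delta> n) \<and>
    J2 ({(\<eta>n n, \<pi>n n) | n. n \<in> N} \<union> {(\<eta>, \<pi>)}) \<and>
    J3 ({(\<eta>n n, \<pi>n n) | n. n \<in> N} \<union> {(\<eta>, \<pi>)}) \<and>
    (continuous_on off_diagonal (\<lambda>(y, z). \<eta> y z) \<and>
     (\<forall>(y, z)\<in>off_diagonal. 0 < \<eta> y z) \<and>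
     absolutely_continuous torus_lebesgue \<pi> \<and>
     (\<exists>c>0. AE z in torus_lebesgue. ennreal c \<le> RN_deriv torus_lebesgue \<pi> z) \<longrightarrow>
     (\<exists>H :: nat \<Rightarrow> 'd torus \<times> 'd torus \<Rightarrow> real.
        (\<forall>n\<in>N. continuous_on off_diagonal (H n) \<and>
          (\<forall>z\<in>off_diagonal. 0 \<le> H n z) \<and>
          (\<forall>p\<in>X n. \<forall>q\<in>X n. p \<noteq> q \<longrightarrow> H n (p, q) = \<eta>n n p q)) \<and>
        (\<forall>K. compact K \<and> K \<subseteq> off_diagonal \<longrightarrow>
          uniform_limit K (\<lambda>m. H (2 ^ m)) (\<lambda>(y, z). \<eta> y z) sequentially)))"
proof -
  note \<pi> = assms(1) and sets = assms(2) and nonneg = assms(3)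
  let ?c = "sqrt (real CARD('d))"
  have N: "n > 0" "n = 1 \<or> n \<ge> 2" if "n \<in> N" for n
  proof -
    show "n > 0" using that by (auto simp: N_def)
    then show "n = 1 \<or> n \<ge> 2" by linarith
  qed
  have grid: "evenly_spaced_grid n (X n)" and Tn: "nearest_point_map (X n) (T n)" if "n \<in> N" for n
    using that assms(9,11) by blast+
  have T: "T n \<in> borel \<rightarrow>\<^sub>M borel" "T n z \<in> X n" if "n \<in> N" for n z
    using Tn[OF that] by (simp_all add: nearest_point_map_def)
  have fin: "finite (X n)" for n by (simp add: X_def)
  have dia: "diameter (T n -` {p}) = ?c / real n" if "n \<in> N" "n \<ge> 2" "p \<in> X n" for n p
    using diameter_cell[OF grid _ Tn] that by blast
  have x1: "x n 1 \<in> X n" if "n \<in> N" for n using N(1)[OF that] by (auto simp: X_def)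
  have \<delta>: "\<delta> n = ?c / real n" if "n \<in> N" "n \<ge> 2" for n
    using dia[OF that x1[OF that(1)]] by (simp add: \<delta>_def)
  have ge2: "n \<ge> 2" if "n \<in> N" "T n y \<noteq> T n z" for n y z
  proof (rule ccontr)
    assume "\<not> n \<ge> 2"
    then have "n = 1" using N(2)[OF that(1)] by simp
    then have "X n = {x n 1}" by (simp add: X_def)
    then show False using T(2)[OF that(1)] that(2) by auto
  qed
  have near: "dist z (T n z) \<le> ?c / (2 * real n)" if "n \<in> N" for n z
    using dist_nearest_grid_point_le[OF grid[OF that] N(1)[OF that] Tn[OF that]] .
  have near\<delta>: "dist z (T n z) \<le> \<delta> n / 2" if "n \<in> N" "T n y \<noteq> T n z" for n y z
    using near[OF that(1), of z] \<delta>[OF that(1) ge2[OF that]] by simp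
  have sep: "dist z (T n z) \<le> ?c / 2 * dist (T n y) (T n z)" if "n \<in> N" "T n y \<noteq> T n z" for n y z
  proof -
    have "1 / real n \<le> dist (T n y) (T n z)"
      using grid_separated[OF grid[OF that(1)] N(1)[OF that(1)] T(2)[OF that(1)] T(2)[OF that(1)] that(2)] .
    then have "?c / 2 * (1 / real n) \<le> ?c / 2 * dist (T n y) (T n z)" by (rule mult_left_mono) simp
    then show ?thesis using near[OF that(1), of z] by simp
  qed
  have "\<forall>n\<in>N. \<forall>j\<in>{1..n ^ CARD('d)}. diameter (T n -` {x n j}) = \<delta> n"
  proof (intro ballI)
    fix n j assume n: "n \<in> N" and j: "j \<in> {1..n ^ CARD('d)}"
    show "diameter (T n -` {x n j}) = \<delta> n"
    proof (cases "n = 1")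
      case True
      then show ?thesis using j by (simp add: \<delta>_def)
    next
      case False
      then show ?thesis using N(2)[OF n] dia[OF n, of "x n j"] \<delta>[OF n] j by (simp add: X_def)
    qed
  qed
  moreover have "J2 ({(\<eta>n n, \<pi>n n) | n. n \<in> N} \<union> {(\<eta>, \<pi>)})"
    unfolding \<eta>n_def \<pi>n_def
    by (rule J2_discretisation[where S = X, OF \<pi> sets nonneg assms(5) T(1) fin T(2) near\<delta>])
  moreover have "J3 ({(\<eta>n n, \<pi>n n) | n. n \<in> N} \<union> {(\<eta>, \<pi>)})"
    unfolding \<eta>n_def \<pi>n_def
    by (rule J3_discretisation[where S = X and c = ?c, OF \<pi> sets nonneg assms(6) T(1) fin T(2) near\<delta> sep _ torus_bounded])
      simp_all
  moreover have "\<exists>H :: nat \<Rightarrow> 'd torus \<times> 'd torus \<Rightarrow> real.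
        (\<forall>n\<in>N. continuous_on off_diagonal (H n) \<and>
          (\<forall>z\<in>off_diagonal. 0 \<le> H n z) \<and>
          (\<forall>p\<in>X n. \<forall>q\<in>X n. p \<noteq> q \<longrightarrow> H n (p, q) = \<eta>n n p q)) \<and>
        (\<forall>K. compact K \<and> K \<subseteq> off_diagonal \<longrightarrow>
          uniform_limit K (\<lambda>m. H (2 ^ m)) (\<lambda>(y, z). \<eta> y z) sequentially)"
    if cont: "continuous_on off_diagonal (\<lambda>(y, z). \<eta> y z)"
      and ac: "absolutely_continuous torus_lebesgue \<pi>"
      and lower: "\<exists>c>0. AE z in torus_lebesgue. ennreal c \<le> RN_deriv torus_lebesgue \<pi> z"
  proof (intro exI conjI ballI allI impI)
    let ?H = "\<lambda>n. bump_extension (1 / real n) (X n) (\<eta>n n) \<eta>"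
    fix n assume n: "n \<in> N"
    show "continuous_on off_diagonal (?H n)" using cont by (rule continuous_on_bump_extension)
    show "0 \<le> ?H n z" for z by (simp add: bump_extension_def)
    fix p q assume pq: "p \<in> X n" "q \<in> X n" "p \<noteq> q"
    show "?H n (p, q) = \<eta>n n p q"
    proof (rule bump_extension_grid[OF fin _ _ pq])
      show "0 < 1 / real n" using N(1)[OF n] by simp
      show "1 / real n \<le> dist p' q'" if "p' \<in> X n" "q' \<in> X n" "p' \<noteq> q'" for p' q'
        using grid_separated[OF grid[OF n] N(1)[OF n] that] .
      show "0 \<le> \<eta>n n p q" unfolding \<eta>n_def using nonneg pq(3) by (rule discrete_kernel_nonneg)
    qed
  next
    fix K :: "('d torus \<times> 'd torus) set" assume K: "compact K \<and> K \<subseteq> off_diagonal"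
    obtain c where c: "c > 0" "AE z in torus_lebesgue. ennreal c \<le> RN_deriv torus_lebesgue \<pi> z"
      using lower by blast
    have N2: "2 ^ m \<in> N" for m by (simp add: N_def)
    have lim0: "(\<lambda>m. a / real (2 ^ m)) \<longlonglongrightarrow> 0" for a
      using tendsto_mult_right_zero[OF LIMSEQ_inverse_realpow_zero[of 2], of a] by (simp add: divide_inverse)
    show "uniform_limit K (\<lambda>m. bump_extension (1 / real (2 ^ m)) (X (2 ^ m)) (\<eta>n (2 ^ m)) \<eta>)
        (\<lambda>(y, z). \<eta> y z) sequentially"
      unfolding \<eta>n_def
    proof (rule uniform_limit_bump_extension[where r = "\<lambda>m. ?c / 2 / real (2 ^ m)", OF \<pi> sets nonneg cont compact_torus T(1)[OF N2] fin])
      show "0 < 1 / real (2 ^ m)" for m by simp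
      show "1 / real (2 ^ m) \<le> dist p q" if "p \<in> X (2 ^ m)" "q \<in> X (2 ^ m)" "p \<noteq> q" for m p q
        using grid_separated[OF grid[OF N2] N(1)[OF N2] that] .
      show "dist z (T (2 ^ m) z) \<le> ?c / 2 / real (2 ^ m)" for m z
        using near[OF N2, of z m] by simp
      show "emeasure \<pi> (T (2 ^ m) -` {p}) > 0" if p: "p \<in> X (2 ^ m)" for m p
      proof -
        let ?B = "ball p (1 / (2 * real (2 ^ m)))"
        have sub: "?B \<subseteq> T (2 ^ m) -` {p}" by (rule ball_subset_cell[OF grid[OF N2] N(1)[OF N2] Tn[OF N2] p])
        have "p \<in> ?B" by simp
        then have "0 < emeasure \<pi> ?B"
          by (intro emeasure_pos_of_RN_deriv_ge[OF sets ac c open_ball]) blast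
        also have "\<dots> \<le> emeasure \<pi> (T (2 ^ m) -` {p})"
          using sub measurable_sets[OF T(1)[OF N2], of "{p}" m] sets by (intro emeasure_mono) auto
        finally show ?thesis .
      qed
      show "(\<lambda>m. 1 / real (2 ^ m)) \<longlonglongrightarrow> 0" "(\<lambda>m. ?c / 2 / real (2 ^ m)) \<longlonglongrightarrow> 0" by (rule lim0)+
      have "\<forall>\<^sub>F m in sequentially. ?c / real (2 ^ m) = \<delta> (2 ^ m)"
        using eventually_ge_at_top[of 1]
      proof eventually_elim
        fix m :: nat assume "1 \<le> m"
        then have "(2 :: nat) ^ 1 \<le> 2 ^ m" by (intro power_increasing) auto
        then show "?c / real (2 ^ m) = \<delta> (2 ^ m)" using \<delta>[OF N2, of m] by simp
      qed
      then show "(\<lambda>m. \<delta> (2 ^ m)) \<longlonglongrightarrow> 0" using lim0 by (rule Lim_transform_eventually[rotated])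
      show "compact K" "K \<subseteq> off_diagonal" using K by blast+
    qed
  qed
  ultimately show ?thesis by blast
qed

end
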